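(* For all positive integers $m$ and $n$, the $m$-Tamari lattice $\mathcal{T}_n^{(m)}$ is EL-shellable. Moreover, the Möbius function of $\mathcal{T}_n^{(m)}$ takes values only in $\{-1,0,1\}$, that is, $\mu(\mathbf{a},\mathbf{b})\in\{-1,0,1\}$ for all $\mathbf{a}\le\mathbf{b}$ in $\mathcal{T}_n^{(m)}$. In particular, for every interval of $\mathcal{T}_n^{(m)}$ with endpoints $\mathbf{a}\le\mathbf{b}$, the open interval $(\mathbf{a},\mathbf{b})$ is homotopy equivalent to either a sphere or a point.
   Context: The lattice $\mathcal{T}_n^{(m)}$: let $\mathcal{D}_n^{(m)}$ be the set of all sequences $\mathbf{a}=(a_1,\ldots,a_n)$ of nonnegative integers with $a_1\le a_2\le\cdots\le a_n$ and $a_i\le m(i-1)$ for $1\le i\le n$. For $\mathbf{a}\in\mathcal{D}_n^{(m)}$ and $i\in\{1,\ldots,n\}$, the primitive subsequence of $\mathbf{a}$ at position $i$ is the unique subsequence $(a_i,a_{i+1},\ldots,a_k)$ such that $a_j-a_i<m(j-i)$ for all $i<j\le k$, and either $k=n$ or $a_{k+1}-a_i\ge m(k+1-i)$. For $\mathbf{a},\mathbf{a}'\in\mathcal{D}_n^{(m)}$ put $\mathbf{a}\lessdot\mathbf{a}'$ if and only if there is $i\in\{1,\ldots,n-1\}$ with $a_i<a_{i+1}$ and $\mathbf{a}'=(a_1,\ldots,a_i,a_{i+1}-1,a_{i+2}-1,\ldots,a_k-1,a_{k+1},\ldots,a_n)$, where $(a_{i+1},\ldots,a_k)$ is the primitive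 subsequence of $\mathbf{a}$ at position $i+1$. Let $\le$ be the reflexive and transitive closure of $\lessdot$. It is known that $(\mathcal{D}_n^{(m)},\le)$ is a lattice; it is the $m$-Tamari lattice $\mathcal{T}_n^{(m)}$. EL-shellability: for a poset $P$, let $\mathcal{E}(P)$ be the set of its covering relations. An edge-labeling of $P$ is a map $\lambda:\mathcal{E}(P)\to\Lambda$ to some poset $\Lambda$. A maximal chain $c:x=p_0\lessdot p_1\lessdot\cdots\lessdot p_s=y$ in an interval $[x,y]$ has label sequence $\lambda(c)=(\lambda(p_0,p_1),\ldots,\lambda(p_{s-1},p_s))$; it is rising if $\lambda(c)$ is strictly increasing. Label sequences are compared lexicographically: $(p_1,\ldots,p_s)\le(q_1,\ldots,q_t)$ if and only if either $s\le t$ and $p_i=q_i$ for $1\le i\le s$, or $p_i<q_i$ for the least $i$ with $p_i\ne q_i$. $\lambda$ is an EL-labeling if every non-singleton interval $[x,y]$ of $P$ has a unique rising maximal chain and this chain is lexicographically first among all maximal chains of $[x,y]$. A bounded poset (one with a unique minimal element $\hat0$ and a unique maximal element $\hat1$) is EL-shellable if it admits an EL-labeling. Topology: the homotopy type of an open interval $(\mathbf{a},\mathbf{b})=\{\mathbf{x}\mid\mathbf{a}<\mathbf{x}<\mathbf{b}\}$ is that of (the geometric realization of) its order complex, the simplicial complex of all finite chains; the empty complex counts as a sphere (of dimension $-1$). *)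

theory Defs
  imports "HOL-Analysis.Analysis"
begin

text \<open>
  A poset is given, as in \<open>HOL.Order_Relation\<close>, by its reflexive order relation \<open>r\<close>, with
  underlying set \<open>Field r\<close>; thus \<open>(x, y) \<in> r\<close> reads \<open>x \<le> y\<close>, and \<open>Partial_order r\<close> says that
  \<open>r\<close> is a partial order.
\<close>

section \<open>Covering relations and EL-shellability\<close>

definition covering_relations :: "'a rel \<Rightarrow> ('a \<times> 'a) set" where
  "covering_relations r =
     {(x, y) \<in> r. x \<noteq> y \<and> (\<forall>z. (x, z) \<in> r \<and> (z, y) \<in> r \<longrightarrow> z = x \<or> z = y)}"

definition maximal_chains :: "'a rel \<Rightarrow> 'a \<Rightarrow> 'a \<Rightarrow> 'a list set" where
  "maximal_chains r x y =
     {c. c \<noteq> [] \<and> hd c = x \<and> last c = y \<and>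
         successively (\<lambda>p q. (p, q) \<in> covering_relations r) c}"

definition label_sequence :: "('a \<times> 'a \<Rightarrow> 'l) \<Rightarrow> 'a list \<Rightarrow> 'l list" where
  "label_sequence lam c = map lam (zip c (tl c))"

definition strictly_increasing :: "'l rel \<Rightarrow> 'l list \<Rightarrow> bool" where
  "strictly_increasing L ps \<longleftrightarrow> successively (\<lambda>p q. (p, q) \<in> L \<and> p \<noteq> q) ps"

definition rising :: "'l rel \<Rightarrow> ('a \<times> 'a \<Rightarrow> 'l) \<Rightarrow> 'a list \<Rightarrow> bool" where
  "rising L lam c \<longleftrightarrow> strictly_increasing L (label_sequence lam c)"

text \<open>The first alternative is the case in which \<open>ps\<close> is a prefix of \<open>qs\<close>.\<close>

definition lex_le :: "'l rel \<Rightarrow> 'l list \<Rightarrow> 'l list \<Rightarrow> bool" where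
  "lex_le L ps qs \<longleftrightarrow>
     (length ps \<le> length qs \<and> (\<forall>i<length ps. ps ! i = qs ! i)) \<or>
     (\<exists>i. i < length ps \<and> i < length qs \<and> (\<forall>j<i. ps ! j = qs ! j) \<and>
          ps ! i \<noteq> qs ! i \<and> (ps ! i, qs ! i) \<in> L)"

definition EL_labeling :: "'a rel \<Rightarrow> 'l rel \<Rightarrow> ('a \<times> 'a \<Rightarrow> 'l) \<Rightarrow> bool" where
  "EL_labeling r L lam \<longleftrightarrow>
     Partial_order L \<and> lam ` covering_relations r \<subseteq> Field L \<and>
     (\<forall>(x, y) \<in> r. x \<noteq> y \<longrightarrow>
        (\<exists>c \<in> maximal_chains r x y.
           rising L lam c \<and>
           (\<forall>c' \<in> maximal_chains r x y. rising L lam c' \<longrightarrow> c' = c) \<and>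
           (\<forall>c' \<in> maximal_chains r x y.
              lex_le L (label_sequence lam c) (label_sequence lam c'))))"

definition bounded_poset :: "'a rel \<Rightarrow> bool" where
  "bounded_poset r \<longleftrightarrow> Partial_order r \<and>
     (\<exists>!x. x \<in> Field r \<and> (\<forall>y. (y, x) \<in> r \<longrightarrow> y = x)) \<and>
     (\<exists>!x. x \<in> Field r \<and> (\<forall>y. (x, y) \<in> r \<longrightarrow> y = x))"

text \<open>
  A definition cannot quantify over the type of labels. Taking the labels in \<open>'a \<times> 'a\<close>, with an
  arbitrary partial order on an arbitrary set of them, loses no generality, because only the labels
  of covering relations matter; see \<open>EL_shellableI\<close> below.
\<close>

definition EL_shellable :: "'a rel \<Rightarrow> bool" where
  "EL_shellable r \<longleftrightarrow> bounded_poset r \<and>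
     (\<exists>(L :: ('a \<times> 'a) rel) (lam :: 'a \<times> 'a \<Rightarrow> 'a \<times> 'a). EL_labeling r L lam)"

lemma set_zip_tl_successively:
  "successively P c \<Longrightarrow> (p, q) \<in> set (zip c (tl c)) \<Longrightarrow> P p q"
  by (induction P c rule: successively.induct) auto

lemma EL_shellableI:
  fixes L :: "'l rel"
  assumes bdd: "bounded_poset r" and EL: "EL_labeling r L lam"
  shows "EL_shellable r"
proof -
  define E where "E = covering_relations r"
  define rep where "rep = inv_into E lam"
  define lam' where "lam' = rep \<circ> lam"
  define L' where "L' = {(rep p, rep q) | p q. p \<in> lam ` E \<and> q \<in> lam ` E \<and> (p, q) \<in> L}"
  have L: "Partial_order L" and sub: "lam ` E \<subseteq> Field L"
    using EL by (auto simp: EL_labeling_def E_def)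
  have refl: "(p, p) \<in> L" if "p \<in> lam ` E" for p
    using that L sub by (auto simp: partial_order_on_def preorder_on_def refl_on_def)
  have inj: "rep p = rep q \<longleftrightarrow> p = q" if "p \<in> lam ` E" "q \<in> lam ` E" for p q
    using that unfolding rep_def by (metis f_inv_into_f)
  have L'_iff: "(rep p, rep q) \<in> L' \<longleftrightarrow> (p, q) \<in> L" if "p \<in> lam ` E" "q \<in> lam ` E" for p q
    using that inj unfolding L'_def by (smt (verit) Pair_inject mem_Collect_eq)
  have F: "Field L' = rep ` lam ` E"
  proof
    show "Field L' \<subseteq> rep ` lam ` E" by (auto simp: L'_def Field_def)
    show "rep ` lam ` E \<subseteq> Field L'"
    proof
      fix a assume "a \<in> rep ` lam ` E"
      then obtain p where "p \<in> lam ` E" "a = rep p" by blast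
      then have "(a, a) \<in> L'" using refl L'_iff by simp
      then show "a \<in> Field L'" by (rule FieldI1)
    qed
  qed
  have tr: "trans L" and asym: "antisym L"
    using L by (auto simp: partial_order_on_def preorder_on_def)
  have L': "Partial_order L'"
    unfolding partial_order_on_def preorder_on_def
  proof (intro conjI)
    show "L' \<subseteq> Field L' \<times> Field L'" by (auto simp: Field_def)
    show "refl_on (Field L') L'"
      using refl L'_iff F by (auto simp: refl_on_def)
    show "trans L'"
    proof (rule transI)
      fix a b c assume ab: "(a, b) \<in> L'" and bc: "(b, c) \<in> L'"
      then obtain p q q' s where
        pq: "a = rep p" "b = rep q" "p \<in> lam ` E" "q \<in> lam ` E" "(p, q) \<in> L" and
        qs: "b = rep q'" "c = rep s" "q' \<in> lam ` E" "s \<in> lam ` E" "(q', s) \<in> L"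
        unfolding L'_def by blast
      have "q = q'" using pq qs inj by metis
      then have "(p, s) \<in> L" using pq qs tr by (meson transD)
      then show "(a, c) \<in> L'" using pq qs L'_iff by simp
    qed
    show "antisym L'"
    proof (rule antisymI)
      fix a b assume ab: "(a, b) \<in> L'" and ba: "(b, a) \<in> L'"
      then obtain p q where
        pq: "a = rep p" "b = rep q" "p \<in> lam ` E" "q \<in> lam ` E" "(p, q) \<in> L"
        unfolding L'_def by blast
      then have "(q, p) \<in> L" using ba L'_iff by simp
      then show "a = b" using pq asym by (metis antisymD)
    qed
  qed
  have labels: "set (label_sequence lam c) \<subseteq> lam ` E" if "c \<in> maximal_chains r x y" for c x y
    using that set_zip_tl_successively
    by (fastforce simp: maximal_chains_def label_sequence_def E_def)
  have seq: "label_sequence lam' c = map rep (label_sequence lam c)" for c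
    by (simp add: label_sequence_def lam'_def)
  have inc: "strictly_increasing L' (map rep ps) \<longleftrightarrow> strictly_increasing L ps"
    if "set ps \<subseteq> lam ` E" for ps
    using that unfolding strictly_increasing_def successively_map
    by (intro successively_cong) (auto simp: L'_iff inj subset_iff)
  have rise: "rising L' lam' c \<longleftrightarrow> rising L lam c" if "c \<in> maximal_chains r x y" for c x y
    using labels[OF that] by (simp add: rising_def seq inc)
  have lex: "lex_le L' (map rep ps) (map rep qs)"
    if "lex_le L ps qs" "set ps \<subseteq> lam ` E" "set qs \<subseteq> lam ` E" for ps qs
  proof -
    have m: "\<And>i. i < length ps \<Longrightarrow> ps ! i \<in> lam ` E" "\<And>i. i < length qs \<Longrightarrow> qs ! i \<in> lam ` E"
      using that(2,3) by (auto dest: nth_mem)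
    from that(1) consider
        "length ps \<le> length qs" "\<forall>i<length ps. ps ! i = qs ! i"
      | i where "i < length ps" "i < length qs" "\<forall>j<i. ps ! j = qs ! j"
          "ps ! i \<noteq> qs ! i" "(ps ! i, qs ! i) \<in> L"
      unfolding lex_le_def by blast
    then show ?thesis
    proof cases
      case 1
      then show ?thesis by (simp add: lex_le_def)
    next
      case 2
      have "rep (ps ! i) \<noteq> rep (qs ! i)" "(rep (ps ! i), rep (qs ! i)) \<in> L'"
        using 2 m inj L'_iff by auto
      then show ?thesis
        using 2 unfolding lex_le_def by (intro disjI2 exI[of _ i]) auto
    qed
  qed
  have "\<forall>(x, y) \<in> r. x \<noteq> y \<longrightarrow>
        (\<exists>c \<in> maximal_chains r x y. rising L lam c \<and>
           (\<forall>c' \<in> maximal_chains r x y. rising L lam c' \<longrightarrow> c' = c) \<and>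
           (\<forall>c' \<in> maximal_chains r x y.
              lex_le L (label_sequence lam c) (label_sequence lam c')))"
    using EL unfolding EL_labeling_def by (elim conjE)
  note ELc = bspec[OF this]
  have "EL_labeling r L' lam'"
    unfolding EL_labeling_def
  proof (intro conjI ballI, goal_cases)
    case 1 show ?case by (fact L')
  next
    case 2 show ?case by (auto simp: F lam'_def E_def)
  next
    case (3 e)
    obtain x y where e: "e = (x, y)" by (cases e)
    show ?case
      unfolding e prod.case
    proof
      assume "x \<noteq> y"
      then obtain c where c: "c \<in> maximal_chains r x y" "rising L lam c"
        "\<forall>c' \<in> maximal_chains r x y. rising L lam c' \<longrightarrow> c' = c"
        "\<forall>c' \<in> maximal_chains r x y. lex_le L (label_sequence lam c) (label_sequence lam c')"
        using ELc[OF 3[unfolded e], unfolded prod.case] by meson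
      show "\<exists>c\<in>maximal_chains r x y. rising L' lam' c \<and>
          (\<forall>c'\<in>maximal_chains r x y. rising L' lam' c' \<longrightarrow> c' = c) \<and>
          (\<forall>c'\<in>maximal_chains r x y. lex_le L' (label_sequence lam' c) (label_sequence lam' c'))"
      proof (intro bexI[of _ c] conjI ballI impI)
        show "rising L' lam' c" using c(1,2) rise by blast
        show "c' = c" if "c' \<in> maximal_chains r x y" "rising L' lam' c'" for c'
          using that c(3) rise by blast
        show "lex_le L' (label_sequence lam' c) (label_sequence lam' c')"
          if "c' \<in> maximal_chains r x y" for c'
          unfolding seq using that c(1,4) labels by (intro lex) auto
        show "c \<in> maximal_chains r x y" by (fact c(1))
      qed
    qed
  qed
  then show ?thesis using bdd unfolding EL_shellable_def by blast
qed

section \<open>The Moebius function\<close>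

definition locally_finite :: "'a rel \<Rightarrow> bool" where
  "locally_finite r \<longleftrightarrow> (\<forall>x y. finite {z. (x, z) \<in> r \<and> (z, y) \<in> r})"

text \<open>
  \<open>\<mu>(x, x) = 1\<close> and \<open>\<mu>(x, y) = - (\<Sum>x \<le> z < y. \<mu>(x, z))\<close> for \<open>x < y\<close>. The guard serves
  termination only; the value 0 for pairs that are not related is the usual convention.
\<close>

function poset_moebius :: "'a rel \<Rightarrow> 'a \<Rightarrow> 'a \<Rightarrow> int" where
  "poset_moebius r x y =
     (if Partial_order r \<and> locally_finite r \<and> (x, y) \<in> r then
        if x = y then 1
        else - (\<Sum>z \<in> {z. (x, z) \<in> r \<and> (z, y) \<in> r \<and> z \<noteq> y}. poset_moebius r x z)
      else 0)"
  by pat_completeness auto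
termination
proof (relation "Wellfounded.measure (\<lambda>(r, x, y). card {z. (x, z) \<in> r \<and> (z, y) \<in> r})", goal_cases)
  case 1
  show ?case by simp
next
  case (2 r x y z)
  then have po: "trans r" "antisym r" "refl_on (Field r) r"
    and fin: "finite {w. (x, w) \<in> r \<and> (w, y) \<in> r}"
    and xy: "(x, y) \<in> r" and z: "(x, z) \<in> r" "(z, y) \<in> r" "z \<noteq> y"
    by (auto simp: partial_order_on_def preorder_on_def locally_finite_def)
  have yy: "(y, y) \<in> r"
    using po(3) xy by (auto simp: refl_on_def Field_def)
  have "{w. (x, w) \<in> r \<and> (w, z) \<in> r} \<subset> {w. (x, w) \<in> r \<and> (w, y) \<in> r}"
    using po(1,2) z xy yy by (auto dest: transD antisymD)
  then show ?case using fin by (simp add: psubset_card_mono)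
qed

declare poset_moebius.simps [simp del]

section \<open>Order complexes and their homotopy type\<close>

definition open_interval :: "'a rel \<Rightarrow> 'a \<Rightarrow> 'a \<Rightarrow> 'a set" where
  "open_interval r x y = {z. (x, z) \<in> r \<and> (z, y) \<in> r \<and> z \<noteq> x \<and> z \<noteq> y}"

definition order_complex :: "'a rel \<Rightarrow> 'a set \<Rightarrow> 'a set set" where
  "order_complex r S = {C \<in> Chains r. finite C \<and> C \<subseteq> S}"

text \<open>
  Points of the geometric realization are given by their barycentric coordinates. The subspace
  topology of the product topology is the right one for finite complexes, the only case in which
  the definition is used below.
\<close>

definition geometric_realization :: "'a set set \<Rightarrow> ('a \<Rightarrow> real) topology" where
  "geometric_realization K =
     subtopology (powertop_real UNIV)
       {t. (\<forall>v. 0 \<le> t v) \<and> {v. t v \<noteq> 0} \<in> K \<and> (\<Sum>v \<in> {v. t v \<noteq> 0}. t v) = 1}"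

text \<open>The library's \<open>nsphere d\<close> has dimension \<open>d\<close>; the empty space is the sphere of dimension -1.\<close>

definition homotopic_to_sphere :: "'b topology \<Rightarrow> bool" where
  "homotopic_to_sphere X \<longleftrightarrow>
     X = trivial_topology \<or> (\<exists>d. X homotopy_equivalent_space nsphere d)"

definition homotopic_to_point :: "'b topology \<Rightarrow> bool" where
  "homotopic_to_point X \<longleftrightarrow> X homotopy_equivalent_space (discrete_topology {()})"

section \<open>The m-Tamari lattices\<close>

text \<open>
  Sequences \<open>(a\<^sub>1, \<dots>, a\<^sub>n)\<close> are lists of length \<open>n\<close>, so that positions are counted from 0 and
  the bound \<open>a\<^sub>i \<le> m (i - 1)\<close> becomes \<open>a ! i \<le> m * i\<close>.
\<close>

definition dyck_sequences :: "nat \<Rightarrow> nat \<Rightarrow> nat list set" where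
  "dyck_sequences m n = {a. length a = n \<and> sorted a \<and> (\<forall>i<n. a ! i \<le> m * i)}"

text \<open>\<open>(a ! i, \<dots>, a ! k)\<close> is the primitive subsequence of \<open>a\<close> at position \<open>i\<close>.\<close>

definition primitive_subsequence :: "nat \<Rightarrow> nat list \<Rightarrow> nat \<Rightarrow> nat \<Rightarrow> bool" where
  "primitive_subsequence m a i k \<longleftrightarrow>
     i \<le> k \<and> k < length a \<and>
     (\<forall>j. i < j \<and> j \<le> k \<longrightarrow> int (a ! j) - int (a ! i) < int (m * (j - i))) \<and>
     (Suc k = length a \<or> int (a ! Suc k) - int (a ! i) \<ge> int (m * (Suc k - i)))"

definition tamari_step :: "nat \<Rightarrow> nat \<Rightarrow> nat list rel" where
  "tamari_step m n =
     {(a, a'). a \<in> dyck_sequences m n \<and> a' \<in> dyck_sequences m n \<and>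
        (\<exists>i k. Suc i < n \<and> a ! i < a ! Suc i \<and> primitive_subsequence m a (Suc i) k \<and>
           a' = map (\<lambda>j. if Suc i \<le> j \<and> j \<le> k then a ! j - 1 else a ! j) [0..<n])}"

definition tamari :: "nat \<Rightarrow> nat \<Rightarrow> nat list rel" where
  "tamari m n = Restr ((tamari_step m n)\<^sup>*) (dyck_sequences m n)"

lemma Field_tamari: "Field (tamari m n) = dyck_sequences m n"
  by (auto simp: tamari_def Field_def)

lemma finite_dyck_sequences: "finite (dyck_sequences m n)"
proof (rule finite_subset)
  show "dyck_sequences m n \<subseteq> {a. set a \<subseteq> {..m * n} \<and> length a = n}"
    by (fastforce simp: dyck_sequences_def in_set_conv_nth intro: le_trans)
qed (simp add: finite_lists_length_eq)

lemma tamari_step_sum_list: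
  assumes "(a, a') \<in> tamari_step m n" shows "sum_list a' < sum_list a"
proof -
  obtain i k where ik: "Suc i < n" "a ! i < a ! Suc i" "primitive_subsequence m a (Suc i) k"
    and a': "a' = map (\<lambda>j. if Suc i \<le> j \<and> j \<le> k then a ! j - 1 else a ! j) [0..<n]"
    and n: "length a = n"
    using assms by (auto simp: tamari_step_def dyck_sequences_def)
  have "sum_list a' = (\<Sum>j<n. if Suc i \<le> j \<and> j \<le> k then a ! j - 1 else a ! j)"
    by (simp add: a' interv_sum_list_conv_sum_set_nat lessThan_atLeast0)
  also have "\<dots> < (\<Sum>j<n. a ! j)"
    using ik by (intro sum_strict_mono_ex1) (auto simp: primitive_subsequence_def intro!: bexI[of _ "Suc i"])
  also have "\<dots> = sum_list a"
    by (simp add: sum_list_sum_nth n lessThan_atLeast0)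
  finally show ?thesis .
qed

lemma Partial_order_tamari: "Partial_order (tamari m n)"
  unfolding Field_tamari partial_order_on_def preorder_on_def
proof (intro conjI)
  show "tamari m n \<subseteq> dyck_sequences m n \<times> dyck_sequences m n" by (auto simp: tamari_def)
  show "refl_on (dyck_sequences m n) (tamari m n)" by (auto simp: refl_on_def tamari_def)
  show "trans (tamari m n)" by (auto simp: tamari_def trans_def)
  have le: "a = b \<or> sum_list b < sum_list a" if "(a, b) \<in> (tamari_step m n)\<^sup>*" for a b
    using that by induction (auto dest: tamari_step_sum_list)
  show "antisym (tamari m n)"
  proof (rule antisymI)
    fix a b assume "(a, b) \<in> tamari m n" "(b, a) \<in> tamari m n"
    then show "a = b" using le[of a b] le[of b a] by (auto simp: tamari_def)
  qed
qed

lemma locally_finite_tamari: "locally_finite (tamari m n)"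
  unfolding locally_finite_def
  by (auto simp: tamari_def intro: finite_subset[OF _ finite_dyck_sequences[of m n]])

lemma primitive_subsequence_unique:
  assumes "primitive_subsequence m a i k" "primitive_subsequence m a i k'"
  shows "k = k'"
proof -
  have "\<not> k < k'" if "primitive_subsequence m a i k" "primitive_subsequence m a i k'" for k k'
  proof
    assume "k < k'"
    then show False
      using that unfolding primitive_subsequence_def
      by (metis Suc_leI le_imp_less_Suc less_le_not_le linorder_not_less)
  qed
  then show ?thesis using assms by (meson linorder_neqE_nat)
qed

end

theory Submission
  imports Defs
begin

text \<open>
  Write \<open>h\<^sub>j = m j - a\<^sub>j\<close> for the heights of a sequence. A covering step at position \<open>p\<close> raises by one
  the heights of the block of \<open>p\<close>, the longest run \<open>p, p + 1, \<dots>, k\<close> in which every later height exceeds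
  \<open>h\<^sub>p\<close>. Two properties of these steps carry everything.

  \<^item> Commutation (\<open>raise_raise\<close>): for \<open>p < q\<close>, a step at \<open>q\<close> followed by one at \<open>p\<close> leads to the same
    sequence as a step at \<open>p\<close> followed by one step at \<open>q\<close>, or by two of them if \<open>q\<close> comes right after
    the block of \<open>p\<close> at the same height.
  \<^item> First difference (\<open>step_first_difference\<close>): if \<open>x < y\<close> and \<open>p\<close> is the first position where they
    differ, then the step at \<open>p\<close> is possible at \<open>x\<close> and stays below \<open>y\<close>. On any path from \<open>x\<close> to \<open>y\<close> the
    first step at \<open>p\<close> can be moved to the front by commutation, because no position before \<open>p\<close> is
    ever used.

  Shellability. Label the step at \<open>p\<close> from \<open>x\<close> by \<open>(p, h\<^sub>p)\<close> and order labels lexicographically. In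
  \<open>[x, y]\<close> the least label that can occur is that of the step at the first difference, and it must
  occur on every maximal chain, since only steps at \<open>p\<close> change \<open>h\<^sub>p\<close>. So a rising chain has to begin
  with it, and by induction there is exactly one rising chain and it is lexicographically first.

  Moebius function and homotopy type. Each interval \<open>[x, y]\<close> has a Galois connection \<open>\<gamma>\<close>, \<open>\<alpha>\<close> with the
  lattice of subsets of \<open>{0, \<dots>, d - 1}\<close> (\<open>boolean_model_exists\<close>), where the indices stand for atoms, \<open>\<gamma> A\<close> is the join
  of the atoms in \<open>A\<close> and \<open>\<alpha> w\<close> the set of atoms below \<open>w\<close>; moreover no proper subset of the atoms has the
  same join as all of them. It is built by induction: with \<open>p\<close> the first difference of \<open>x\<close> and \<open>y\<close>,
  the elements of \<open>[x, w]\<close> that agree with \<open>x\<close> at \<open>p\<close> have a greatest element \<open>\<kappa> w\<close>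
  (\<open>greatest_with_same_height\<close>, the form of meet-semidistributivity that is needed), so \<open>[x, \<kappa> y]\<close>
  contributes all atoms but one, and the join with the remaining atom is a single step at \<open>p\<close>.

  Given such a Galois connection, \<open>\<mu>(x, y)\<close> is the sum of \<open>(-1)\<^sup>|\<^sup>A\<^sup>|\<close> over the sets \<open>A\<close> with
  \<open>\<gamma> A = y\<close>. At most the full set qualifies, whence \<open>\<mu>(x, y) \<in> {-1, 0, 1}\<close>. If the join of all atoms
  lies strictly below \<open>y\<close>, it is the apex of a contraction of the open interval; otherwise the
  connection restricts to a homotopy equivalence between the open interval and the proper part of a
  Boolean lattice, the barycentric subdivision of the boundary of a simplex.
\<close>

section \<open>Homotopy of maps between order complexes\<close>

definition order_realization :: "'a rel \<Rightarrow> 'a set \<Rightarrow> ('a \<Rightarrow> real) topology" where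
  "order_realization r S = geometric_realization (order_complex r S)"

lemma in_order_realization_iff:
  assumes "finite S"
  shows "t \<in> topspace (order_realization r S) \<longleftrightarrow>
    (\<forall>v. 0 \<le> t v) \<and> (\<forall>v. t v \<noteq> 0 \<longrightarrow> v \<in> S) \<and>
    (\<forall>u v. t u \<noteq> 0 \<longrightarrow> t v \<noteq> 0 \<longrightarrow> (u, v) \<in> r \<or> (v, u) \<in> r) \<and> sum t S = 1"
proof -
  have eq: "(\<Sum>v | t v \<noteq> 0. t v) = sum t S" if "\<forall>v. t v \<noteq> 0 \<longrightarrow> v \<in> S"
    using assms that by (intro sum.mono_neutral_left) auto
  have "{v. t v \<noteq> 0} \<in> order_complex r S \<longleftrightarrow> (\<forall>v. t v \<noteq> 0 \<longrightarrow> v \<in> S) \<and>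
    (\<forall>u v. t u \<noteq> 0 \<longrightarrow> t v \<noteq> 0 \<longrightarrow> (u, v) \<in> r \<or> (v, u) \<in> r)"
    using finite_subset[OF _ assms, of "{v. t v \<noteq> 0}"]
    by (auto simp: order_complex_def Chains_def)
  then show ?thesis
    using eq by (auto simp: order_realization_def geometric_realization_def)
qed

lemma continuous_map_coordinate [continuous_intros]:
  "continuous_map (order_realization r S) euclideanreal (\<lambda>t. t v)"
  unfolding order_realization_def geometric_realization_def
  by (intro continuous_map_from_subtopology continuous_map_product_projection) simp

lemma continuous_map_into_order_realization:
  assumes "\<And>v. continuous_map X euclideanreal (\<lambda>x. f x v)"
    and "\<And>x. x \<in> topspace X \<Longrightarrow> f x \<in> topspace (order_realization r S)"
  shows "continuous_map X (order_realization r S) f"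
  using assms unfolding order_realization_def geometric_realization_def
  by (intro continuous_map_into_subtopology) (auto simp: continuous_map_componentwise_UNIV)

text \<open>The affine map of geometric realizations induced by a map of vertices: it moves the mass at each
vertex to the image vertex.\<close>

definition push :: "'a set \<Rightarrow> ('a \<Rightarrow> 'b) \<Rightarrow> ('a \<Rightarrow> real) \<Rightarrow> 'b \<Rightarrow> real" where
  "push S f t q = (\<Sum>c \<in> {c \<in> S. f c = q}. t c)"

lemma push_nonzeroE:
  assumes "push S f t q \<noteq> 0"
  obtains c where "c \<in> S" "f c = q" "t c \<noteq> 0"
  using assms unfolding push_def by (metis (mono_tags, lifting) mem_Collect_eq sum.not_neutral_contains_not_neutral)

lemma sum_push:
  assumes "finite S" "finite T" "f ` S \<subseteq> T"
  shows "sum (push S f t) T = sum t S"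
  unfolding push_def using sum.group[of S T f t] assms by simp

lemma push_push:
  assumes "finite S" "finite T" "f ` S \<subseteq> T"
  shows "push T g (push S f t) = push S (g \<circ> f) t"
proof
  fix q
  have "push T g (push S f t) q = (\<Sum>p \<in> {p \<in> T. g p = q}. \<Sum>c \<in> {c \<in> {c \<in> S. g (f c) = q}. f c = p}. t c)"
    unfolding push_def by (intro sum.cong refl) auto
  also have "\<dots> = (\<Sum>c \<in> {c \<in> S. g (f c) = q}. t c)"
    using assms by (intro sum.group) auto
  finally show "push T g (push S f t) q = push S (g \<circ> f) t q" by (simp add: push_def)
qed

lemma push_id:
  assumes "\<And>v. t v \<noteq> 0 \<Longrightarrow> v \<in> S"
  shows "push S id t = t"
proof
  fix q
  have "{c \<in> S. id c = q} = (if q \<in> S then {q} else {})" by auto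
  then show "push S id t q = t q" using assms by (auto simp: push_def)
qed

text \<open>The part of the mass \<open>t c\<close> that belongs to the topmost total mass \<open>s\<close> of \<open>t\<close>, when the mass of \<open>t\<close> is
stacked along the chain that supports it. Writing it as a difference of truncated tail sums makes it
visibly continuous in \<open>s\<close> and \<open>t\<close>.\<close>

definition upper_mass :: "'a rel \<Rightarrow> 'a set \<Rightarrow> real \<Rightarrow> ('a \<Rightarrow> real) \<Rightarrow> 'a \<Rightarrow> real" where
  "upper_mass r S s t c =
     min s (\<Sum>d \<in> {d \<in> S. (c, d) \<in> r}. t d) - min s (\<Sum>d \<in> {d \<in> S. (c, d) \<in> r \<and> d \<noteq> c}. t d)"

definition mono_between :: "'a rel \<Rightarrow> 'a set \<Rightarrow> 'b rel \<Rightarrow> 'b set \<Rightarrow> ('a \<Rightarrow> 'b) \<Rightarrow> bool" where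
  "mono_between r S r' T f \<longleftrightarrow> f ` S \<subseteq> T \<and> (\<forall>c\<in>S. \<forall>d\<in>S. (c, d) \<in> r \<longrightarrow> (f c, f d) \<in> r')"

text \<open>Comparable maps are homotopic. A straight-line homotopy leaves the complex, because the images of one
chain under \<open>f\<close> and \<open>g\<close> together need not form a chain. Instead, at time \<open>s\<close> the topmost mass \<open>s\<close> of
\<open>t\<close> is moved by \<open>g\<close> and the rest by \<open>f\<close>. If \<open>c\<close> still has mass moved by \<open>f\<close> and \<open>d\<close> already has mass
moved by \<open>g\<close>, then \<open>c \<le> d\<close>, so that \<open>f c \<le> f d \<le> g d\<close> and the support of the image is a chain.\<close>

lemma homotopic_push:
  fixes f g :: "'a \<Rightarrow> 'b"
  assumes S: "finite S" "\<And>c. c \<in> S \<Longrightarrow> (c, c) \<in> r" "trans r"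
    and T: "finite T" "trans r'"
    and f: "mono_between r S r' T f" and g: "mono_between r S r' T g"
    and fg: "\<And>c. c \<in> S \<Longrightarrow> (f c, g c) \<in> r'"
  shows "homotopic_with (\<lambda>_. True) (order_realization r S) (order_realization r' T) (push S f) (push S g)"
proof -
  let ?X = "order_realization r S" and ?I = "top_of_set {0..1::real}"
  define up where "up t c = (\<Sum>d \<in> {d \<in> S. (c, d) \<in> r}. t d)" for t :: "'a \<Rightarrow> real" and c
  define up' where "up' t c = (\<Sum>d \<in> {d \<in> S. (c, d) \<in> r \<and> d \<noteq> c}. t d)" for t :: "'a \<Rightarrow> real" and c
  have um: "upper_mass r S s t c = min s (up t c) - min s (up' t c)" for s t c
    by (simp add: upper_mass_def up_def up'_def)
  have up: "up t c = up' t c + t c" if "c \<in> S" for t c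
  proof -
    have "{d \<in> S. (c, d) \<in> r} = insert c {d \<in> S. (c, d) \<in> r \<and> d \<noteq> c}" using S(2) that by auto
    then show ?thesis using S(1) by (simp add: up_def up'_def)
  qed
  define h where "h = (\<lambda>(s, t) q. push S f (\<lambda>c. t c - upper_mass r S s t c) q + push S g (upper_mass r S s t) q)"
  have bounds: "0 \<le> upper_mass r S s t c" "upper_mass r S s t c \<le> t c" "0 \<le> up' t c" "up t c \<le> 1"
    if t: "t \<in> topspace ?X" and c: "c \<in> S" for s t c
  proof -
    have pos: "0 \<le> t d" for d using t in_order_realization_iff[OF S(1)] by blast
    show "0 \<le> upper_mass r S s t c" "upper_mass r S s t c \<le> t c"
      using up[OF c, of t] pos[of c] by (auto simp: um min_def)
    show "0 \<le> up' t c" unfolding up'_def using pos by (intro sum_nonneg) auto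
    have "up t c \<le> sum t S" unfolding up_def using pos S(1) by (intro sum_mono2) auto
    then show "up t c \<le> 1" using t in_order_realization_iff[OF S(1), of t r] by simp
  qed
  have pt: "h (s, t) \<in> topspace (order_realization r' T)" if s: "0 \<le> s" "s \<le> 1" and t: "t \<in> topspace ?X" for s t
  proof -
    let ?m = "upper_mass r S s t"
    have t': "\<And>v. 0 \<le> t v" "\<And>v. t v \<noteq> 0 \<Longrightarrow> v \<in> S"
      "\<And>u v. t u \<noteq> 0 \<Longrightarrow> t v \<noteq> 0 \<Longrightarrow> (u, v) \<in> r \<or> (v, u) \<in> r" "sum t S = 1"
      using t in_order_realization_iff[OF S(1)] by blast+
    have fT: "f ` S \<subseteq> T" and gT: "g ` S \<subseteq> T" using f g by (auto simp: mono_between_def)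
    have fm: "\<And>c d. c \<in> S \<Longrightarrow> d \<in> S \<Longrightarrow> (c, d) \<in> r \<Longrightarrow> (f c, f d) \<in> r'"
      and gm: "\<And>c d. c \<in> S \<Longrightarrow> d \<in> S \<Longrightarrow> (c, d) \<in> r \<Longrightarrow> (g c, g d) \<in> r'"
      using f g by (auto simp: mono_between_def)
    have nn: "0 \<le> h (s, t) q" for q
      unfolding h_def prod.case push_def using bounds[OF t] by (intro add_nonneg_nonneg sum_nonneg) auto
    have src: "(\<exists>c\<in>S. f c = q \<and> t c \<noteq> 0 \<and> ?m c < t c) \<or> (\<exists>c\<in>S. g c = q \<and> t c \<noteq> 0 \<and> 0 < ?m c)"
      if "h (s, t) q \<noteq> 0" for q
    proof -
      have "push S f (\<lambda>c. t c - ?m c) q \<noteq> 0 \<or> push S g ?m q \<noteq> 0"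
        using that by (auto simp: h_def)
      then show ?thesis
      proof
        assume "push S f (\<lambda>c. t c - ?m c) q \<noteq> 0"
        then obtain c where "c \<in> S" "f c = q" "t c - ?m c \<noteq> 0" by (rule push_nonzeroE)
        then show ?thesis using bounds(1,2)[OF t, of c s] by (intro disjI1 bexI[of _ c]) auto
      next
        assume "push S g ?m q \<noteq> 0"
        then obtain c where "c \<in> S" "g c = q" "?m c \<noteq> 0" by (rule push_nonzeroE)
        then show ?thesis using bounds(1,2)[OF t, of c s] by (intro disjI2 bexI[of _ c]) auto
      qed
    qed
    \<comment> \<open>If \<open>d\<close> were strictly below \<open>c\<close>, all of the mass at \<open>c\<close> would lie within the topmost mass \<open>s\<close>.\<close>
    have cross: "(c, d) \<in> r" if "c \<in> S" "d \<in> S" "t c \<noteq> 0" "t d \<noteq> 0" "?m c < t c" "0 < ?m d" for c d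
    proof (rule ccontr)
      assume n: "(c, d) \<notin> r"
      then have dc: "(d, c) \<in> r" "d \<noteq> c" using t'(3)[of c d] that S(2) by auto
      have "up t c \<le> up' t d"
        unfolding up_def up'_def
      proof (rule sum_mono2)
        show "{x \<in> S. (c, x) \<in> r} \<subseteq> {x \<in> S. (d, x) \<in> r \<and> x \<noteq> d}"
          using dc n S(3) by (auto dest: transD)
      qed (use S t' in auto)
      moreover have "up' t d < s" using that(6) up[OF that(2), of t] t'(1)[of d] by (auto simp: um min_def split: if_splits)
      ultimately have "?m c = t c" using up[OF that(1), of t] t'(1)[of c] by (auto simp: um min_def)
      then show False using that by simp
    qed
    show ?thesis
      unfolding in_order_realization_iff[OF T(1)]
    proof (intro conjI allI impI)
      show "0 \<le> h (s, t) v" for v by (rule nn)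
      show "v \<in> T" if "h (s, t) v \<noteq> 0" for v using src[OF that] fT gT by auto
      show "(u, v) \<in> r' \<or> (v, u) \<in> r'" if "h (s, t) u \<noteq> 0" "h (s, t) v \<noteq> 0" for u v
        using src[OF that(1)] src[OF that(2)]
      proof (elim disjE bexE conjE)
        fix c d assume "c \<in> S" "f c = u" "t c \<noteq> 0" "d \<in> S" "f d = v" "t d \<noteq> 0"
        then show ?thesis using t'(3)[of c d] fm by auto
      next
        fix c d assume "c \<in> S" "g c = u" "t c \<noteq> 0" "d \<in> S" "g d = v" "t d \<noteq> 0"
        then show ?thesis using t'(3)[of c d] gm by auto
      next
        fix c d assume a: "c \<in> S" "f c = u" "t c \<noteq> 0" "?m c < t c" "d \<in> S" "g d = v" "t d \<noteq> 0" "0 < ?m d"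
        then have "(f c, f d) \<in> r'" using cross[of c d] fm by auto
        then show ?thesis using fg[of d] a T(2) by (auto dest: transD)
      next
        fix c d assume a: "c \<in> S" "g c = u" "t c \<noteq> 0" "0 < ?m c" "d \<in> S" "f d = v" "t d \<noteq> 0" "?m d < t d"
        then have "(f d, f c) \<in> r'" using cross[of d c] fm by auto
        then show ?thesis using fg[of c] a T(2) by (auto dest: transD)
      qed
      have "sum (h (s, t)) T = sum (push S f (\<lambda>c. t c - ?m c)) T + sum (push S g ?m) T"
        by (simp add: h_def sum.distrib)
      also have "\<dots> = 1"
        using sum_push[OF S(1) T(1) fT] sum_push[OF S(1) T(1) gT] t'(4) by (simp add: sum_subtractf)
      finally show "sum (h (s, t)) T = 1" .
    qed
  qed
  have "continuous_map (prod_topology ?I ?X) (order_realization r' T) h"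
  proof (rule continuous_map_into_order_realization)
    fix q
    have coord: "continuous_map (prod_topology ?I ?X) euclideanreal (\<lambda>x. snd x c)" for c
      using continuous_map_compose[OF continuous_map_snd continuous_map_coordinate, of ?I r S c]
      by (simp add: o_def)
    have time: "continuous_map (prod_topology ?I ?X) euclideanreal fst"
      using continuous_map_fst[of ?I ?X] continuous_map_into_fulltopology by blast
    show "continuous_map (prod_topology ?I ?X) euclideanreal (\<lambda>x. h x q)"
      unfolding h_def push_def upper_mass_def case_prod_beta using S(1)
      by (intro continuous_intros coord time) auto
  next
    fix x assume "x \<in> topspace (prod_topology ?I ?X)"
    then show "h x \<in> topspace (order_realization r' T)" using pt[of "fst x" "snd x"] by (cases x) auto
  qed
  moreover have "h (0, t) = push S f t" if t: "t \<in> topspace ?X" for t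
  proof -
    have "upper_mass r S 0 t c = 0" if "c \<in> S" for c
      using bounds[OF t that] up[OF that, of t] in_order_realization_iff[OF S(1), of t r] t by (auto simp: um)
    then show ?thesis by (auto simp: h_def push_def)
  qed
  moreover have "h (1, t) = push S g t" if t: "t \<in> topspace ?X" for t
  proof -
    have "upper_mass r S 1 t c = t c" if "c \<in> S" for c
      using bounds[OF t that] up[OF that, of t] in_order_realization_iff[OF S(1), of t r] t 
      by (smt (verit) um)
    then show ?thesis by (auto simp: h_def push_def)
  qed
  ultimately show ?thesis by (subst homotopic_with) auto
qed

lemma continuous_map_push:
  assumes S: "finite S" and T: "finite T" and f: "mono_between r S r' T f"
  shows "continuous_map (order_realization r S) (order_realization r' T) (push S f)"
proof (rule continuous_map_into_order_realization)
  show "continuous_map (order_realization r S) euclideanreal (\<lambda>t. push S f t v)" for v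
    unfolding push_def using S by (intro continuous_intros) auto
next
  fix t assume t: "t \<in> topspace (order_realization r S)"
  have fT: "f ` S \<subseteq> T" using f by (auto simp: mono_between_def)
  show "push S f t \<in> topspace (order_realization r' T)"
    unfolding in_order_realization_iff[OF T]
  proof (intro conjI allI impI)
    show "0 \<le> push S f t v" for v
      using t unfolding push_def in_order_realization_iff[OF S] by (intro sum_nonneg) auto
    show "v \<in> T" if "push S f t v \<noteq> 0" for v
      using push_nonzeroE[OF that] fT by blast
    show "(u, v) \<in> r' \<or> (v, u) \<in> r'" if "push S f t u \<noteq> 0" "push S f t v \<noteq> 0" for u v
      using push_nonzeroE[OF that(1)] push_nonzeroE[OF that(2)] t f
      unfolding in_order_realization_iff[OF S] mono_between_def by metis
    show "sum (push S f t) T = 1"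
      using sum_push[OF S T fT] t unfolding in_order_realization_iff[OF S] by simp
  qed
qed

lemma mono_between_id: "mono_between r S r S id"
  by (simp add: mono_between_def)

text \<open>Both composites are comparable with the identity.\<close>

lemma homotopy_equivalent_Galois:
  assumes S: "finite S" "\<And>c. c \<in> S \<Longrightarrow> (c, c) \<in> r" "trans r"
    and T: "finite T" "\<And>c. c \<in> T \<Longrightarrow> (c, c) \<in> r'" "trans r'"
    and f: "mono_between r S r' T f" and g: "mono_between r' T r S g"
    and gf: "\<And>c. c \<in> S \<Longrightarrow> (g (f c), c) \<in> r" and fg: "\<And>c. c \<in> T \<Longrightarrow> (c, f (g c)) \<in> r'"
  shows "order_realization r S homotopy_equivalent_space order_realization r' T"
proof -
  have im: "f ` S \<subseteq> T" "g ` T \<subseteq> S" using f g by (auto simp: mono_between_def)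
  have gfm: "mono_between r S r S (g \<circ> f)" and fgm: "mono_between r' T r' T (f \<circ> g)"
    using f g by (auto simp: mono_between_def image_subset_iff)
  have idS: "push S id t = id t" if "t \<in> topspace (order_realization r S)" for t
    using that push_id[of t S] in_order_realization_iff[OF S(1)] by simp
  have idT: "push T id t = id t" if "t \<in> topspace (order_realization r' T)" for t
    using that push_id[of t T] in_order_realization_iff[OF T(1)] by simp
  have "homotopic_with (\<lambda>_. True) (order_realization r S) (order_realization r S) (push S (g \<circ> f)) (push S id)"
    using S gfm gf by (intro homotopic_push) (auto simp: mono_between_id)
  then have 1: "homotopic_with (\<lambda>_. True) (order_realization r S) (order_realization r S) (push T g \<circ> push S f) id"
    by (rule homotopic_with_eq) (auto simp: push_push S T im idS)
  have "homotopic_with (\<lambda>_. True) (order_realization r' T) (order_realization r' T) (push T id) (push T (f \<circ> g))"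
    using T fgm fg by (intro homotopic_push) (auto simp: mono_between_id)
  then have "homotopic_with (\<lambda>_. True) (order_realization r' T) (order_realization r' T) id (push S f \<circ> push T g)"
    by (rule homotopic_with_eq) (auto simp: push_push S T im idT)
  then have 2: "homotopic_with (\<lambda>_. True) (order_realization r' T) (order_realization r' T) (push S f \<circ> push T g) id"
    by (rule homotopic_with_symD)
  show ?thesis
    unfolding homotopy_equivalent_space_def
    using 1 2 continuous_map_push[OF S(1) T(1) f] continuous_map_push[OF T(1) S(1) g] by blast
qed

text \<open>The identity is comparable with \<open>g\<close>, and \<open>g\<close> with the constant map to \<open>e\<close>.\<close>

lemma homotopic_to_point_conical:
  assumes S: "finite S" "\<And>c. c \<in> S \<Longrightarrow> (c, c) \<in> r" "trans r"
    and g: "mono_between r S r S g" and e: "e \<in> S"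
    and gc: "\<And>c. c \<in> S \<Longrightarrow> (g c, c) \<in> r" and ge: "\<And>c. c \<in> S \<Longrightarrow> (g c, e) \<in> r"
  shows "homotopic_to_point (order_realization r S)"
proof -
  let ?X = "order_realization r S"
  have const: "mono_between r S r S (\<lambda>_. e)" using e S(2) by (auto simp: mono_between_def)
  have idS: "push S id t = id t" if "t \<in> topspace ?X" for t
    using that push_id[of t S] in_order_realization_iff[OF S(1)] by simp
  have "homotopic_with (\<lambda>_. True) ?X ?X (push S g) (push S id)"
    using S g gc by (intro homotopic_push) (auto simp: mono_between_id)
  then have 1: "homotopic_with (\<lambda>_. True) ?X ?X (push S id) (push S g)" by (rule homotopic_with_symD)
  have "homotopic_with (\<lambda>_. True) ?X ?X (push S g) (push S (\<lambda>_. e))"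
    using S g const ge by (intro homotopic_push) auto
  with 1 have "homotopic_with (\<lambda>_. True) ?X ?X (push S id) (push S (\<lambda>_. e))" by (rule homotopic_with_trans)
  then have "homotopic_with (\<lambda>_. True) ?X ?X id (\<lambda>_. \<lambda>v. if v = e then 1 else 0)"
    by (rule homotopic_with_eq)
      (auto simp: idS push_def in_order_realization_iff[OF S(1)])
  then have 2: "homotopic_with (\<lambda>_. True) ?X ?X ((\<lambda>_. \<lambda>v. if v = e then 1 else 0) \<circ> (\<lambda>_. ())) id"
    by (intro homotopic_with_symD[of _ _ _ id]) (simp add: o_def)
  have pt: "(\<lambda>v. if v = e then 1 else 0) \<in> topspace ?X"
    using S e by (auto simp: in_order_realization_iff[OF S(1)] split: if_splits)
  have 3: "homotopic_with (\<lambda>_. True) (discrete_topology {()}) (discrete_topology {()})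
      ((\<lambda>_. ()) \<circ> (\<lambda>_. \<lambda>v. if v = e then 1 else 0)) id"
    by (rule homotopic_with_equal) auto
  show ?thesis
    unfolding homotopic_to_point_def homotopy_equivalent_space_def using 2 3 pt
    by (intro exI[of _ "\<lambda>_. ()"] exI[of _ "\<lambda>_. \<lambda>v. if v = e then 1 else (0::real)"] conjI) auto
qed

section \<open>The proper part of a Boolean lattice is a sphere\<close>

definition proper_subsets :: "'i set \<Rightarrow> 'i set set" where
  "proper_subsets S = {A. A \<subseteq> S \<and> A \<noteq> {} \<and> A \<noteq> S}"

definition subset_order :: "'i set rel" where
  "subset_order = {(A, B). A \<subseteq> B}"

text \<open>The map from the barycentric subdivision to the ambient Euclidean space: \<open>t\<close> is sent to the
combination of the indicator functions of the sets \<open>A\<close> with coefficients \<open>t A\<close>. Its values have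
minimum 0 and maximum 1 (\<open>Min_level\<close> and \<open>Max_level\<close>).\<close>

definition level :: "'i set \<Rightarrow> ('i set \<Rightarrow> real) \<Rightarrow> 'i \<Rightarrow> real" where
  "level S t i = (\<Sum>A \<in> {A \<in> proper_subsets S. i \<in> A}. t A)"

text \<open>The length of the set of thresholds \<open>s\<close> for which \<open>A\<close> is the superlevel set of \<open>f\<close> at \<open>s\<close>. It inverts
\<open>level\<close>, by \<open>gap_level\<close> and \<open>layer_cake\<close>.\<close>

definition gap :: "'i set \<Rightarrow> ('i \<Rightarrow> real) \<Rightarrow> 'i set \<Rightarrow> real" where
  "gap S f A = max 0 (Min (f ` A) - Max (f ` (S - A)))"

definition spread :: "'i set \<Rightarrow> ('i \<Rightarrow> real) \<Rightarrow> real" where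
  "spread S f = Max (f ` S) - Min (f ` S)"

lemma finite_proper_subsets: "finite S \<Longrightarrow> finite (proper_subsets S)"
  by (simp add: proper_subsets_def)

lemma gap_positiveD:
  assumes "finite S" "A \<subseteq> S" "0 < gap S f A" "i \<in> A" "j \<in> S - A"
  shows "f j < f i"
proof -
  have "Max (f ` (S - A)) < Min (f ` A)" using assms(3) by (auto simp: gap_def max_def split: if_splits)
  moreover have "Min (f ` A) \<le> f i" "f j \<le> Max (f ` (S - A))"
    using assms finite_subset[of A S] by auto
  ultimately show ?thesis by linarith
qed

lemma gap_chain:
  assumes "finite S" "A \<subseteq> S" "B \<subseteq> S" "0 < gap S f A" "0 < gap S f B"
  shows "A \<subseteq> B \<or> B \<subseteq> A"
proof (rule ccontr)
  assume "\<not> ?thesis"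
  then obtain i j where "i \<in> A" "i \<notin> B" "j \<in> B" "j \<notin> A" by blast
  then show False using gap_positiveD[of S A f i j] gap_positiveD[of S B f j i] assms by fastforce
qed

text \<open>For thresholds \<open>s\<close> between \<open>Min (f ` S)\<close> and \<open>f i\<close>, the superlevel set of \<open>f\<close> at \<open>s\<close> is a proper subset
that contains \<open>i\<close>. Sorting the interval of these thresholds by the superlevel set and adding up
lengths gives the identity.\<close>

lemma layer_cake:
  assumes S: "finite S" and i: "i \<in> S"
  shows "level S (gap S f) i = f i - Min (f ` S)"
proof -
  let ?Q = "{A \<in> proper_subsets S. i \<in> A}"
  \<comment> \<open>the thresholds whose superlevel set is \<open>A\<close>\<close>
  define I where "I A = {Max (f ` (S - A))<..Min (f ` A)}" for A
  have lev: "{j \<in> S. s \<le> f j} = A" if "A \<in> proper_subsets S" "s \<in> I A" for A s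
  proof -
    have "finite A" "finite (S - A)" using that S by (auto simp: proper_subsets_def intro: finite_subset)
    then have "s \<le> f j" if "j \<in> A" for j
      using \<open>s \<in> I A\<close> that unfolding I_def by (meson Min_le finite_imageI greaterThanAtMost_iff image_eqI order_trans)
    moreover have "f j < s" if "j \<in> S - A" for j
      using \<open>s \<in> I A\<close> that \<open>finite (S - A)\<close> unfolding I_def
      by (meson Max_ge finite_imageI greaterThanAtMost_iff image_eqI order_le_less_trans)
    ultimately show ?thesis using that(1) by (fastforce simp: proper_subsets_def)
  qed
  have Un: "(\<Union>A\<in>?Q. I A) = {Min (f ` S)<..f i}"
  proof (intro equalityI subsetI)
    fix s assume "s \<in> (\<Union>A\<in>?Q. I A)"
    then obtain A where A: "A \<in> proper_subsets S" "i \<in> A" "s \<in> I A" by blast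
    then have "s \<le> f i" using lev[OF A(1,3)] by blast
    moreover obtain j where j: "j \<in> S" "j \<notin> A" using A(1) by (auto simp: proper_subsets_def)
    then have "\<not> s \<le> f j" using lev[OF A(1,3)] by blast
    then have "Min (f ` S) < s" using j S by (meson Min_le finite_imageI image_eqI not_le order_le_less_trans)
    ultimately show "s \<in> {Min (f ` S)<..f i}" by simp
  next
    fix s assume s: "s \<in> {Min (f ` S)<..f i}"
    define A where "A = {j \<in> S. s \<le> f j}"
    have "Min (f ` S) \<in> f ` S" using S i by (intro Min_in) auto
    then obtain j where "j \<in> S" "f j = Min (f ` S)" by auto
    then have j: "j \<in> S - A" using s by (auto simp: A_def)
    have iA: "i \<in> A" using s i by (auto simp: A_def)
    then have "A \<in> ?Q" using j by (auto simp: proper_subsets_def A_def)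
    moreover have "s \<in> I A"
    proof -
      have fin: "finite A" "finite (S - A)" using S by (auto simp: A_def)
      have "Max (f ` (S - A)) < s" using fin j by (subst Max_less_iff) (auto simp: A_def)
      moreover have "s \<le> Min (f ` A)" using fin iA by (subst Min_ge_iff) (auto simp: A_def)
      ultimately show ?thesis by (simp add: I_def)
    qed
    ultimately show "s \<in> (\<Union>A\<in>?Q. I A)" by blast
  qed
  have mI: "emeasure lborel (I A) = ennreal (gap S f A)" for A
    by (cases "Max (f ` (S - A)) \<le> Min (f ` A)") (auto simp: I_def gap_def max_def)
  have fI: "emeasure lborel (I A) < top" for A by (simp add: mI)
  have "disjoint_family_on I ?Q"
    unfolding disjoint_family_on_def using lev by blast
  then have "measure lborel (\<Union>A\<in>?Q. I A) = (\<Sum>A\<in>?Q. measure lborel (I A))"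
    using S by (intro measure_finite_Union) (auto simp: fI[THEN less_imp_neq] finite_proper_subsets, auto simp: I_def)
  also have "\<dots> = (\<Sum>A\<in>?Q. gap S f A)"
    unfolding measure_def mI by (simp add: gap_def)
  finally have "f i - Min (f ` S) = (\<Sum>A\<in>?Q. gap S f A)"
    using S i by (simp add: Un)
  then show ?thesis by (simp add: level_def)
qed

text \<open>Only sets that contain a point \<open>i\<close> where \<open>f\<close> is maximal have a positive gap, so this is \<open>layer_cake\<close>
at that point.\<close>

lemma sum_gap:
  assumes S: "finite S" "S \<noteq> {}"
  shows "sum (gap S f) (proper_subsets S) = spread S f"
proof -
  have "Max (f ` S) \<in> f ` S" using S by (intro Max_in) auto
  then obtain i where i: "i \<in> S" "f i = Max (f ` S)" by auto
  have "gap S f A = 0" if "A \<in> proper_subsets S" "i \<notin> A" for A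
  proof (rule ccontr)
    assume "gap S f A \<noteq> 0"
    then have "0 < gap S f A" by (simp add: gap_def max_def split: if_splits)
    moreover obtain j where "j \<in> A" using \<open>A \<in> proper_subsets S\<close> unfolding proper_subsets_def by blast
    ultimately have "f i < f j" "j \<in> S" using gap_positiveD[of S A f j i] that S i by (auto simp: proper_subsets_def)
    then show False using i S by (metis Max_ge finite_imageI image_eqI not_le)
  qed
  then have "sum (gap S f) (proper_subsets S) = level S (gap S f) i"
    unfolding level_def using S by (intro sum.mono_neutral_right) (auto simp: finite_proper_subsets)
  then show ?thesis using layer_cake[OF S(1) i(1)] i(2) by (simp add: spread_def)
qed

lemma chain_has_greatest:
  assumes "finite C" "C \<noteq> {}" "\<And>A B. A \<in> C \<Longrightarrow> B \<in> C \<Longrightarrow> A \<subseteq> B \<or> B \<subseteq> A"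
  obtains M where "M \<in> C" "\<And>A. A \<in> C \<Longrightarrow> A \<subseteq> M"
  using finite_has_maximal[OF assms(1,2)] assms(3) by metis

lemma chain_has_least:
  assumes "finite C" "C \<noteq> {}" "\<And>A B. A \<in> C \<Longrightarrow> B \<in> C \<Longrightarrow> A \<subseteq> B \<or> B \<subseteq> A"
  obtains M where "M \<in> C" "\<And>A. A \<in> C \<Longrightarrow> M \<subseteq> A"
  using finite_has_minimal[OF assms(1,2)] assms(3) by metis

context
  fixes S :: "'i set" and t :: "'i set \<Rightarrow> real"
  assumes S: "finite S" and t: "t \<in> topspace (order_realization subset_order (proper_subsets S))"
begin

private lemma t_facts:
  "0 \<le> t A" "t A \<noteq> 0 \<Longrightarrow> A \<in> proper_subsets S"
  "t A \<noteq> 0 \<Longrightarrow> t B \<noteq> 0 \<Longrightarrow> A \<subseteq> B \<or> B \<subseteq> A" "sum t (proper_subsets S) = 1"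
  using t in_order_realization_iff[OF finite_proper_subsets[OF S]] by (auto simp: subset_order_def)

private lemma fin: "finite (proper_subsets S)"
  by (rule finite_proper_subsets[OF S])

private lemma level_eq:
  assumes "\<And>B. t B \<noteq> 0 \<Longrightarrow> i \<in> B \<longleftrightarrow> P B"
  shows "level S t i = sum t {B \<in> proper_subsets S. P B}"
proof -
  have "level S t i = sum t {B \<in> proper_subsets S. t B \<noteq> 0 \<and> i \<in> B}"
    unfolding level_def using fin by (intro sum.mono_neutral_right) auto
  also have "{B \<in> proper_subsets S. t B \<noteq> 0 \<and> i \<in> B} = {B \<in> proper_subsets S. t B \<noteq> 0 \<and> P B}"
    using assms by blast
  also have "sum t \<dots> = sum t {B \<in> proper_subsets S. P B}"
    using fin by (intro sum.mono_neutral_left) auto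
  finally show ?thesis .
qed

private lemma level_le:
  assumes "\<And>B. t B \<noteq> 0 \<Longrightarrow> i \<in> B \<Longrightarrow> P B"
  shows "level S t i \<le> sum t {B \<in> proper_subsets S. P B}"
proof -
  have "level S t i = sum t {B \<in> proper_subsets S. i \<in> B \<and> P B}"
    using assms by (intro level_eq) blast
  also have "\<dots> \<le> sum t {B \<in> proper_subsets S. P B}"
    using fin t_facts(1) by (intro sum_mono2) auto
  finally show ?thesis .
qed

private lemma level_ge:
  assumes "\<And>B. P B \<Longrightarrow> i \<in> B"
  shows "sum t {B \<in> proper_subsets S. P B} \<le> level S t i"
  unfolding level_def using fin t_facts(1) assms by (intro sum_mono2) auto

private lemma support:
  "finite {A. t A \<noteq> 0}" "{A. t A \<noteq> 0} \<noteq> {}"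
proof -
  show "finite {A. t A \<noteq> 0}" using t_facts(2) by (intro finite_subset[OF _ fin]) blast
  show "{A. t A \<noteq> 0} \<noteq> {}"
  proof
    assume "{A. t A \<noteq> 0} = {}"
    then have "t A = 0" for A by blast
    then show False using t_facts(4) by simp
  qed
qed

lemma Min_level: "Min (level S t ` S) = 0"
proof -
  obtain M where M: "t M \<noteq> 0" "\<And>A. t A \<noteq> 0 \<Longrightarrow> A \<subseteq> M"
    by (rule chain_has_greatest[OF support]) (use t_facts(3) in auto)
  obtain j where j: "j \<in> S" "j \<notin> M" using t_facts(2)[OF M(1)] by (auto simp: proper_subsets_def)
  have "level S t j = sum t {B \<in> proper_subsets S. False}" using M j by (intro level_eq) blast
  moreover have "0 \<le> level S t i" for i unfolding level_def using t_facts(1) by (intro sum_nonneg)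
  ultimately show ?thesis using S j by (intro Min_eqI) (auto intro!: image_eqI[of _ _ j])
qed

lemma Max_level: "Max (level S t ` S) = 1"
proof -
  obtain M where M: "t M \<noteq> 0" "\<And>A. t A \<noteq> 0 \<Longrightarrow> M \<subseteq> A"
    by (rule chain_has_least[OF support]) (use t_facts(3) in auto)
  obtain j where j: "j \<in> S" "j \<in> M" using t_facts(2)[OF M(1)] by (auto simp: proper_subsets_def)
  have "level S t j = sum t {B \<in> proper_subsets S. True}" using M j by (intro level_eq) blast
  moreover have "level S t i \<le> sum t {B \<in> proper_subsets S. True}" for i by (rule level_le) simp
  ultimately show ?thesis using S j t_facts(4) by (intro Max_eqI) (auto intro!: image_eqI[of _ _ j])
qed

text \<open>If \<open>A\<close> is comparable with all sets in the support of \<open>t\<close>, then the minimum of the levels on \<open>A\<close> is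
attained at a point of \<open>A\<close> outside all smaller sets of the support, and the maximum off \<open>A\<close> at a point
common to all larger ones; they differ by exactly \<open>t A\<close>. If some \<open>B\<close> in the support is incomparable
with \<open>A\<close>, then points of \<open>B - A\<close> have at least the level of points of \<open>A - B\<close>, so both sides vanish.\<close>

lemma gap_level:
  assumes A: "A \<in> proper_subsets S"
  shows "gap S (level S t) A = t A"
proof (cases "\<forall>B. t B \<noteq> 0 \<longrightarrow> A \<subseteq> B \<or> B \<subseteq> A")
  case True
  define up where "up = sum t {B \<in> proper_subsets S. A \<subset> B}"
  have A': "A \<subseteq> S" "A \<noteq> {}" "A \<noteq> S" "finite A" using A S by (auto simp: proper_subsets_def finite_subset)
  have "{B \<in> proper_subsets S. A \<subseteq> B} = insert A {B \<in> proper_subsets S. A \<subset> B}" using A by auto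
  then have upA: "sum t {B \<in> proper_subsets S. A \<subseteq> B} = up + t A" using fin by (simp add: up_def)
  have "Min (level S t ` A) = up + t A"
  proof (rule Min_eqI)
    show "finite (level S t ` A)" using A' by simp
    show "up + t A \<le> y" if "y \<in> level S t ` A" for y
      using that unfolding upA[symmetric] by (auto intro!: level_ge)
    obtain i where i: "i \<in> A" "\<And>B. t B \<noteq> 0 \<Longrightarrow> B \<subset> A \<Longrightarrow> i \<notin> B"
    proof (cases "{B. t B \<noteq> 0 \<and> B \<subset> A} = {}")
      case True
      then show ?thesis using A'(2) that by blast
    next
      case False
      have "finite {B. t B \<noteq> 0 \<and> B \<subset> A}" by (rule finite_subset[OF _ support(1)]) auto
      then obtain M where "t M \<noteq> 0 \<and> M \<subset> A" "\<And>B. t B \<noteq> 0 \<and> B \<subset> A \<Longrightarrow> B \<subseteq> M"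
        by (rule chain_has_greatest[OF _ False]) (use t_facts(3) in auto)
      then show ?thesis using that by blast
    qed
    have "level S t i = sum t {B \<in> proper_subsets S. A \<subseteq> B}"
      using i True by (intro level_eq) blast
    then show "up + t A \<in> level S t ` A" using i(1) upA by (metis image_eqI)
  qed
  moreover have "Max (level S t ` (S - A)) = up"
  proof (rule Max_eqI)
    show "finite (level S t ` (S - A))" using S by simp
    show "y \<le> up" if "y \<in> level S t ` (S - A)" for y
      using that True unfolding up_def by (auto intro!: level_le)
    obtain j where j: "j \<in> S - A" "\<And>B. t B \<noteq> 0 \<Longrightarrow> A \<subset> B \<Longrightarrow> j \<in> B"
    proof (cases "{B. t B \<noteq> 0 \<and> A \<subset> B} = {}")
      case True
      then show ?thesis using A' that by blast
    next
      case False
      have "finite {B. t B \<noteq> 0 \<and> A \<subset> B}" by (rule finite_subset[OF _ support(1)]) auto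
      then obtain M where M: "t M \<noteq> 0 \<and> A \<subset> M" "\<And>B. t B \<noteq> 0 \<and> A \<subset> B \<Longrightarrow> M \<subseteq> B"
        by (rule chain_has_least[OF _ False]) (use t_facts(3) in auto)
      then have "M \<subseteq> S" using t_facts(2) by (auto simp: proper_subsets_def)
      then show ?thesis using that M by blast
    qed
    have "level S t j = up"
      unfolding up_def using j True by (intro level_eq) blast
    then show "up \<in> level S t ` (S - A)" using j by auto
  qed
  ultimately show ?thesis using t_facts(1)[of A] by (simp add: gap_def)
next
  case False
  then obtain B i j where B: "t B \<noteq> 0" "i \<in> A" "i \<notin> B" "j \<in> B" "j \<notin> A" by blast
  have A': "A \<subseteq> S" "finite A" "finite (S - A)" using A S by (auto simp: proper_subsets_def finite_subset)
  have "level S t i \<le> level S t j"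
    unfolding level_def[of S t j] using B t_facts(3) by (intro level_le) blast
  moreover have "j \<in> S" using B t_facts(2) by (auto simp: proper_subsets_def)
  then have "level S t j \<le> Max (level S t ` (S - A))" using A' B by simp
  moreover have "Min (level S t ` A) \<le> level S t i" using A' B by simp
  moreover have "t A = 0" using B t_facts(3) by blast
  ultimately show ?thesis by (simp add: gap_def)
qed

end

lemma gap_affine:
  assumes "finite S" "A \<in> proper_subsets S" "0 \<le> a" and g: "\<And>i. i \<in> S \<Longrightarrow> g i = a * f i + b"
  shows "gap S g A = a * gap S f A"
proof -
  have A: "A \<noteq> {}" "S - A \<noteq> {}" "finite A" "A \<subseteq> S" using assms by (auto simp: proper_subsets_def finite_subset)
  have m: "mono (\<lambda>x. a * x + b)" using assms(3) by (intro monoI) (simp add: mult_left_mono)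
  have "g ` A = (\<lambda>x. a * x + b) ` f ` A" "g ` (S - A) = (\<lambda>x. a * x + b) ` f ` (S - A)"
    unfolding image_image using g A(4) by (auto intro!: image_cong)
  then have "Min (g ` A) = a * Min (f ` A) + b" "Max (g ` (S - A)) = a * Max (f ` (S - A)) + b"
    using mono_Min_commute[OF m, of "f ` A"] mono_Max_commute[OF m, of "f ` (S - A)"] A assms(1) by auto
  then have "Min (g ` A) - Max (g ` (S - A)) = a * (Min (f ` A) - Max (f ` (S - A)))"
    by (simp add: right_diff_distrib)
  then show ?thesis using assms(3) by (simp add: gap_def max_mult_distrib_left)
qed

lemma spread_affine:
  assumes "finite S" "S \<noteq> {}" "0 \<le> a" and g: "\<And>i. i \<in> S \<Longrightarrow> g i = a * f i + b"
  shows "spread S g = a * spread S f"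
proof -
  have m: "mono (\<lambda>x. a * x + b)" using assms(3) by (intro monoI) (simp add: mult_left_mono)
  have "g ` S = (\<lambda>x. a * x + b) ` f ` S"
    unfolding image_image using g by (auto intro!: image_cong)
  then show ?thesis
    using mono_Min_commute[OF m, of "f ` S"] mono_Max_commute[OF m, of "f ` S"] assms(1,2)
    by (simp add: spread_def algebra_simps)
qed

lemma continuous_map_Min_Max:
  assumes "finite A" "A \<noteq> {}" "\<And>i. i \<in> A \<Longrightarrow> continuous_map X euclideanreal (\<lambda>x. f x i)"
  shows "continuous_map X euclideanreal (\<lambda>x. Min (f x ` A))"
    and "continuous_map X euclideanreal (\<lambda>x. Max (f x ` A))"
proof -
  have "continuous_map X euclideanreal (\<lambda>x. Min (f x ` A)) \<and>
      continuous_map X euclideanreal (\<lambda>x. Max (f x ` A))"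
    using assms
    by (induction A rule: finite_ne_induct) (auto intro!: continuous_map_real_min continuous_map_real_max)
  then show "continuous_map X euclideanreal (\<lambda>x. Min (f x ` A))"
    "continuous_map X euclideanreal (\<lambda>x. Max (f x ` A))" by blast+
qed

context
  fixes e :: nat
begin

private abbreviation "S \<equiv> {..Suc e}"
private abbreviation "R \<equiv> order_realization subset_order (proper_subsets S)"

private definition "dif t i = level S t i - level S t (Suc e)"
private definition "N t = sqrt (\<Sum>i\<le>e. (dif t i)\<^sup>2)"
private definition "F t i = (if i \<le> e then dif t i / N t else 0)"
private definition "G v A = (if A \<in> proper_subsets S then gap S v A / spread S v else 0)"

private lemma sphere_iff:
  "v \<in> topspace (nsphere e) \<longleftrightarrow> (\<forall>i>e. v i = 0) \<and> (\<Sum>i\<le>e. (v i)\<^sup>2) = 1"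
  by (auto simp: nsphere topspace_Euclidean_space)

private lemma N_pos: "0 < N t" if t: "t \<in> topspace R"
proof -
  have "\<exists>i\<le>e. dif t i \<noteq> 0"
  proof (rule ccontr)
    assume "\<not> ?thesis"
    then have "level S t i = level S t (Suc e)" if "i \<in> S" for i
      using that by (cases "i = Suc e") (auto simp: dif_def)
    then have "level S t ` S = (\<lambda>_. level S t (Suc e)) ` S" by (rule image_cong[OF refl])
    also have "\<dots> = {level S t (Suc e)}" by (rule image_constant[of 0]) simp
    finally show False using Min_level[OF _ t] Max_level[OF _ t] by simp
  qed
  then obtain i where "i \<le> e" "dif t i \<noteq> 0" by blast
  then have "0 < (\<Sum>i\<le>e. (dif t i)\<^sup>2)" by (intro sum_pos2[of _ i]) auto
  then show ?thesis by (simp add: N_def)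
qed

private lemma spread_pos: "0 < spread S v" if v: "v \<in> topspace (nsphere e)"
proof -
  have le: "Min (v ` S) \<le> v i" "v i \<le> Max (v ` S)" if "i \<in> S" for i using that by auto
  have "v (Suc e) = 0" using v by (simp add: sphere_iff)
  moreover obtain i where "i \<le> e" "v i \<noteq> 0"
    using v unfolding sphere_iff by (metis (no_types, lifting) atMost_iff sum.neutral zero_power2 zero_neq_one)
  moreover have "Suc e \<in> S" "i \<in> S" using \<open>i \<le> e\<close> by auto
  ultimately have "Min (v ` S) < Max (v ` S)" using le[of "Suc e"] le[of i] by linarith
  then show ?thesis by (simp add: spread_def)
qed

private lemma F_affine: "F t i = 1 / N t * level S t i + (- level S t (Suc e) / N t)" if "i \<in> S"
  using that by (cases "i = Suc e") (auto simp: F_def dif_def diff_divide_distrib)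

private lemma F_in: "F t \<in> topspace (nsphere e)" if t: "t \<in> topspace R"
proof -
  have "(\<Sum>i\<le>e. (F t i)\<^sup>2) = (\<Sum>i\<le>e. (dif t i)\<^sup>2) / (N t)\<^sup>2"
    by (simp add: F_def power_divide sum_divide_distrib)
  also have "(\<Sum>i\<le>e. (dif t i)\<^sup>2) = (N t)\<^sup>2" by (simp add: N_def sum_nonneg)
  finally show ?thesis using N_pos[OF t] by (simp add: sphere_iff F_def)
qed

private lemma G_in: "G v \<in> topspace R" if v: "v \<in> topspace (nsphere e)"
proof -
  have fin: "finite (proper_subsets S)" by (simp add: finite_proper_subsets)
  have nz: "A \<in> proper_subsets S \<and> 0 < gap S v A" if "G v A \<noteq> 0" for A
    using that by (auto simp: G_def gap_def max_def split: if_splits)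
  show ?thesis
    unfolding in_order_realization_iff[OF fin]
  proof (intro conjI allI impI)
    show "0 \<le> G v A" for A using spread_pos[OF v] by (simp add: G_def gap_def)
    show "A \<in> proper_subsets S" if "G v A \<noteq> 0" for A using nz[OF that] by simp
    show "(A, B) \<in> subset_order \<or> (B, A) \<in> subset_order" if "G v A \<noteq> 0" "G v B \<noteq> 0" for A B
      using gap_chain[of S A B v] nz[OF that(1)] nz[OF that(2)] by (auto simp: subset_order_def proper_subsets_def)
    have "sum (G v) (proper_subsets S) = sum (gap S v) (proper_subsets S) / spread S v"
      by (simp add: G_def sum_divide_distrib)
    then show "sum (G v) (proper_subsets S) = 1" using spread_pos[OF v] sum_gap[of S v] by simp
  qed
qed

private lemma GF: "G (F t) = t" if t: "t \<in> topspace R"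
proof
  fix A
  show "G (F t) A = t A"
  proof (cases "A \<in> proper_subsets S")
    case True
    have "gap S (F t) A = 1 / N t * t A"
      using gap_affine[of S A "1 / N t" "F t", OF _ True _ F_affine] N_pos[OF t] gap_level[OF _ t True] by simp
    moreover have "spread S (F t) = 1 / N t * spread S (level S t)"
      using spread_affine[of S "1 / N t" "F t", OF _ _ _ F_affine] N_pos[OF t] by simp
    moreover have "spread S (level S t) = 1"
      using Min_level[OF _ t] Max_level[OF _ t] by (simp add: spread_def)
    ultimately show ?thesis using True N_pos[OF t] by (simp add: G_def)
  next
    case False
    have "finite (proper_subsets S)" by (simp add: finite_proper_subsets)
    from in_order_realization_iff[OF this, THEN iffD1, OF t]
    have "\<forall>v. t v \<noteq> 0 \<longrightarrow> v \<in> proper_subsets S" by (elim conjE)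
    then have "t A \<noteq> 0 \<longrightarrow> A \<in> proper_subsets S" by (rule spec)
    with False have "t A = 0" by blast
    then show ?thesis using False by (simp add: G_def)
  qed
qed

private lemma FG: "F (G v) = v" if v: "v \<in> topspace (nsphere e)"
proof
  fix i
  have 0: "v j = 0" if "e < j" for j using v that by (simp add: sphere_iff)
  have "level S (G v) j = level S (gap S v) j / spread S v" for j
    unfolding level_def sum_divide_distrib by (intro sum.cong) (auto simp: G_def)
  then have "level S (G v) j = (v j - Min (v ` S)) / spread S v" if "j \<in> S" for j
    using layer_cake[of S j v] that by simp
  then have d: "dif (G v) j = v j / spread S v" if "j \<le> e" for j
    using that 0[of "Suc e"] by (simp add: dif_def diff_divide_distrib)
  have "(\<Sum>j\<le>e. (dif (G v) j)\<^sup>2) = (\<Sum>j\<le>e. (v j)\<^sup>2) / (spread S v)\<^sup>2"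
    by (simp add: d power_divide sum_divide_distrib)
  then have "N (G v) = 1 / spread S v"
    using v spread_pos[OF v] by (simp add: N_def sphere_iff real_sqrt_divide)
  then show "F (G v) i = v i" using d[of i] 0[of i] spread_pos[OF v] by (simp add: F_def)
qed

text \<open>The levels form a nonconstant function on \<open>{0, \<dots>, e + 1}\<close>. Up to positive affine changes such functions
are the points of an \<open>e\<close>-sphere: subtracting the last value leaves a nonzero vector with \<open>e + 1\<close>
coordinates, which \<open>F\<close> normalizes to length 1. Gaps rescale under affine changes, so \<open>G\<close> recovers \<open>t\<close>
after division by the spread.\<close>

lemma proper_subsets_homeomorphic_nsphere: "R homeomorphic_space nsphere e"
proof -
  have cF: "continuous_map R (nsphere e) F"
    unfolding nsphere
  proof (intro continuous_map_into_subtopology)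
    have lev: "continuous_map R euclideanreal (\<lambda>t. level S t i)" for i
      unfolding level_def by (intro continuous_intros) (auto simp: finite_proper_subsets)
    have dif: "continuous_map R euclideanreal (\<lambda>t. dif t i)" for i
      unfolding dif_def by (intro continuous_intros lev)
    have norm: "continuous_map R euclideanreal (\<lambda>t. N t)"
      unfolding N_def power2_eq_square by (intro continuous_intros dif) auto
    have "continuous_map R euclideanreal (\<lambda>t. F t i)" for i
    proof (cases "i \<le> e")
      case True
      have "continuous_map R euclideanreal (\<lambda>t. dif t i / N t)"
        using N_pos[THEN less_imp_neq] by (intro continuous_map_real_divide dif norm) metis
      then show ?thesis using True by (simp add: F_def)
    qed (simp add: F_def)
    then show "continuous_map R (powertop_real UNIV) F" by (simp add: continuous_map_componentwise_UNIV)
    show "F \<in> topspace R \<rightarrow> {x. (\<Sum>i\<le>e. (x i)\<^sup>2) = 1 \<and> (\<forall>i>e. x i = 0)}"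
      using F_in by (auto simp: sphere_iff)
  qed
  have cG: "continuous_map (nsphere e) R G"
  proof (rule continuous_map_into_order_realization)
    have v: "continuous_map (nsphere e) euclideanreal (\<lambda>v. v i)" for i
      unfolding nsphere by (intro continuous_map_from_subtopology continuous_map_product_projection) simp
    have m: "continuous_map (nsphere e) euclideanreal (\<lambda>v. Min (v ` A))"
        "continuous_map (nsphere e) euclideanreal (\<lambda>v. Max (v ` A))" if "finite A" "A \<noteq> {}" for A
      using continuous_map_Min_Max[OF that v] by auto
    fix A
    show "continuous_map (nsphere e) euclideanreal (\<lambda>v. G v A)"
    proof (cases "A \<in> proper_subsets S")
      case True
      then have A: "finite A" "A \<noteq> {}" "finite (S - A)" "S - A \<noteq> {}"
        by (auto simp: proper_subsets_def finite_subset)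
      have "continuous_map (nsphere e) euclideanreal (\<lambda>v. gap S v A)"
        unfolding gap_def by (intro continuous_intros m A) auto
      moreover have "continuous_map (nsphere e) euclideanreal (\<lambda>v. spread S v)"
        unfolding spread_def by (intro continuous_intros m) auto
      moreover have "spread S v \<noteq> 0" if "v \<in> topspace (nsphere e)" for v
        using spread_pos[OF that] by simp
      ultimately have "continuous_map (nsphere e) euclideanreal (\<lambda>v. gap S v A / spread S v)"
        by (rule continuous_map_real_divide)
      then show ?thesis using True by (simp add: G_def)
    qed (simp add: G_def)
  qed (rule G_in)
  show ?thesis
    unfolding homeomorphic_space_def homeomorphic_maps_def
    by (intro exI[of _ F] exI[of _ G] conjI ballI cF cG GF FG)
qed

end

section \<open>Intervals compared with a Boolean lattice\<close>

text \<open>A Galois connection between the interval \<open>[x, y]\<close> and the lattice of subsets of \<open>{..<d}\<close>. The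
assumption \<open>alpha_empty\<close> makes \<open>x\<close> the only element that is above no atom, and \<open>gamma_full\<close> makes the
join of all \<open>d\<close> atoms irredundant. So if this join is \<open>y\<close>, then the proper parts correspond.\<close>

locale boolean_model =
  fixes r :: "'a rel" and x y :: 'a and d :: nat and \<alpha> :: "'a \<Rightarrow> nat set" and \<gamma> :: "nat set \<Rightarrow> 'a"
  assumes order: "Partial_order r"
    and fin: "finite {w. (x, w) \<in> r \<and> (w, y) \<in> r}"
    and xy: "(x, y) \<in> r"
    and alpha_sub: "(x, w) \<in> r \<Longrightarrow> (w, y) \<in> r \<Longrightarrow> \<alpha> w \<subseteq> {..<d}"
    and gamma_in: "A \<subseteq> {..<d} \<Longrightarrow> (x, \<gamma> A) \<in> r \<and> (\<gamma> A, y) \<in> r"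
    and Galois: "A \<subseteq> {..<d} \<Longrightarrow> (x, w) \<in> r \<Longrightarrow> (w, y) \<in> r \<Longrightarrow> (\<gamma> A, w) \<in> r \<longleftrightarrow> A \<subseteq> \<alpha> w"
    and alpha_empty: "(x, w) \<in> r \<Longrightarrow> (w, y) \<in> r \<Longrightarrow> \<alpha> w = {} \<longleftrightarrow> w = x"
    and gamma_full: "A \<subseteq> {..<d} \<Longrightarrow> \<gamma> A = \<gamma> {..<d} \<Longrightarrow> A = {..<d}"
begin

lemma refl: "(x, w) \<in> r \<Longrightarrow> (w, w) \<in> r"
  using order by (auto simp: partial_order_on_def preorder_on_def refl_on_def intro: FieldI2)

lemma trans: "(u, v) \<in> r \<Longrightarrow> (v, w) \<in> r \<Longrightarrow> (u, w) \<in> r"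
  using order by (auto simp: partial_order_on_def preorder_on_def dest: transD)

lemma antisym: "(u, v) \<in> r \<Longrightarrow> (v, u) \<in> r \<Longrightarrow> u = v"
  using order by (auto simp: partial_order_on_def dest: antisymD)

lemma gamma_alpha_le: "(x, w) \<in> r \<Longrightarrow> (w, y) \<in> r \<Longrightarrow> (\<gamma> (\<alpha> w), w) \<in> r"
  using Galois alpha_sub by simp

lemma alpha_gamma_ge: "A \<subseteq> {..<d} \<Longrightarrow> A \<subseteq> \<alpha> (\<gamma> A)"
  using Galois[of A "\<gamma> A"] gamma_in refl by blast

lemma gamma_mono:
  assumes "A \<subseteq> B" "B \<subseteq> {..<d}" shows "(\<gamma> A, \<gamma> B) \<in> r"
  using Galois[of A "\<gamma> B"] alpha_gamma_ge[of B] gamma_in[of B] assms by blast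

lemma alpha_mono:
  assumes "(x, v) \<in> r" "(v, w) \<in> r" "(w, y) \<in> r" shows "\<alpha> v \<subseteq> \<alpha> w"
proof -
  have v: "(v, y) \<in> r" and w: "(x, w) \<in> r" using assms trans by blast+
  have "(\<gamma> (\<alpha> v), w) \<in> r" using gamma_alpha_le[OF assms(1) v] assms(2) trans by blast
  then show ?thesis using Galois[OF alpha_sub[OF assms(1) v] w assms(3)] by simp
qed

lemma gamma_eq_bottom:
  assumes "A \<subseteq> {..<d}" "\<gamma> A = x" shows "A = {}"
  using alpha_gamma_ge[OF assms(1)] alpha_empty[of x] xy refl[OF xy] assms(2) order
  by (metis FieldI1 gamma_in partial_order_on_def preorder_on_def refl_onD subset_empty)

lemma sum_alternating:
  fixes B :: "nat set" assumes "finite B"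
  shows "(\<Sum>A\<in>Pow B. (-1::int) ^ card A) = (if B = {} then 1 else 0)"
proof -
  have "(\<Prod>i\<in>B. (-1::int) + 1) = (\<Sum>A\<in>Pow B. (\<Prod>i\<in>A. -1) * (\<Prod>i\<in>B - A. 1))"
    using assms by (rule prod_add)
  then show ?thesis using assms by (simp add: prod_constant power_0_left)
qed

text \<open>Both sides satisfy the same recursion: the sum of the right-hand sides over \<open>[x, w]\<close> is the
alternating sum over all subsets of \<open>\<alpha> w\<close>, by the Galois connection, and this vanishes unless
\<open>\<alpha> w\<close> is empty, that is, unless \<open>w = x\<close>.\<close>

lemma moebius_eq:
  assumes "locally_finite r" "(x, w) \<in> r" "(w, y) \<in> r"
  shows "poset_moebius r x w = (\<Sum>A | A \<subseteq> {..<d} \<and> \<gamma> A = w. (-1) ^ card A)"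
  using assms(2,3)
proof (induction "card {z. (x, z) \<in> r \<and> (z, w) \<in> r}" arbitrary: w rule: less_induct)
  case less
  define g where "g v = (\<Sum>A | A \<subseteq> {..<d} \<and> \<gamma> A = v. (-1::int) ^ card A)" for v
  let ?I = "{z. (x, z) \<in> r \<and> (z, w) \<in> r}"
  have finI: "finite ?I" using assms(1) by (simp add: locally_finite_def)
  have sub: "\<alpha> w \<subseteq> {..<d}" using alpha_sub less.prems by blast
  have "sum g ?I = (\<Sum>z\<in>?I. \<Sum>A | A \<in> Pow (\<alpha> w) \<and> \<gamma> A = z. (-1) ^ card A)"
    unfolding g_def
  proof (rule sum.cong[OF HOL.refl], rule sum.cong)
    fix z assume z: "z \<in> ?I"
    have "A \<subseteq> \<alpha> w" if "A \<subseteq> {..<d}" "\<gamma> A = z" for A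
      using Galois[OF that(1) less.prems] that(2) z by simp
    then show "{A. A \<subseteq> {..<d} \<and> \<gamma> A = z} = {A. A \<in> Pow (\<alpha> w) \<and> \<gamma> A = z}" using sub by auto
  qed simp
  also have "\<dots> = (\<Sum>A\<in>Pow (\<alpha> w). (-1) ^ card A)"
  proof (rule sum.group)
    show "finite (Pow (\<alpha> w))" using sub by (simp add: finite_subset)
    show "\<gamma> ` Pow (\<alpha> w) \<subseteq> ?I"
    proof (rule image_subsetI)
      fix A assume A: "A \<in> Pow (\<alpha> w)"
      then have "A \<subseteq> {..<d}" using sub by blast
      then show "\<gamma> A \<in> ?I" using A Galois[OF _ less.prems, of A] gamma_in[of A] by simp
    qed
  qed (rule finI)
  also have "\<dots> = (if w = x then 1 else 0)"
    using sum_alternating[of "\<alpha> w"] alpha_empty[OF less.prems] sub by (simp add: finite_subset)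
  finally have total: "sum g ?I = (if w = x then 1 else 0)" .
  have wI: "w \<in> ?I" using less.prems refl by blast
  have I: "?I = insert w {z. (x, z) \<in> r \<and> (z, w) \<in> r \<and> z \<noteq> w}" using wI by auto
  have IH: "poset_moebius r x z = g z" if z: "(x, z) \<in> r" "(z, w) \<in> r" "z \<noteq> w" for z
    unfolding g_def
  proof (rule less.hyps)
    have "{v. (x, v) \<in> r \<and> (v, z) \<in> r} \<subseteq> ?I" using trans[OF _ z(2)] by blast
    moreover have "w \<notin> {v. (x, v) \<in> r \<and> (v, z) \<in> r}" using z antisym by blast
    ultimately have "{v. (x, v) \<in> r \<and> (v, z) \<in> r} \<subset> ?I" using wI by blast
    then show "card {v. (x, v) \<in> r \<and> (v, z) \<in> r} < card ?I" using finI by (rule psubset_card_mono[rotated])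
    show "(z, y) \<in> r" using z less.prems trans by blast
  qed (use z in blast)
  show ?case
  proof (cases "w = x")
    case True
    have "?I = {x}" using antisym wI by (auto simp: True)
    then have "g x = 1" using total by (simp add: True)
    moreover have "poset_moebius r x x = 1"
      using poset_moebius.simps[of r x x] order assms(1) wI by (simp add: True)
    ultimately show ?thesis by (simp add: True g_def)
  next
    case False
    have "poset_moebius r x w = - (\<Sum>z | (x, z) \<in> r \<and> (z, w) \<in> r \<and> z \<noteq> w. poset_moebius r x z)"
      using poset_moebius.simps[of r x w] order assms(1) less.prems False by simp
    also have "\<dots> = - (\<Sum>z | (x, z) \<in> r \<and> (z, w) \<in> r \<and> z \<noteq> w. g z)"
      using IH by simp
    also have "\<dots> = g w" using total False finI unfolding I by simp
    finally show ?thesis by (simp add: g_def)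
  qed
qed

lemma only_full_joins_to_top:
  assumes "A \<subseteq> {..<d}" "\<gamma> A = y"
  shows "A = {..<d}"
proof -
  have "(y, \<gamma> {..<d}) \<in> r" using gamma_mono[OF assms(1) order_refl] assms(2) by simp
  then have "\<gamma> {..<d} = y" using gamma_in[OF order_refl] antisym by blast
  then show ?thesis using gamma_full assms by simp
qed

lemma moebius_value:
  assumes "locally_finite r"
  shows "poset_moebius r x y \<in> {-1, 0, 1}"
proof -
  have eq: "poset_moebius r x y = (\<Sum>A | A \<subseteq> {..<d} \<and> \<gamma> A = y. (-1) ^ card A)"
    using moebius_eq[OF assms xy] refl xy order trans by (metis (no_types, lifting) gamma_in order_refl refl)
  have "{A. A \<subseteq> {..<d} \<and> \<gamma> A = y} \<subseteq> {{..<d}}" using only_full_joins_to_top by auto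
  then consider "{A. A \<subseteq> {..<d} \<and> \<gamma> A = y} = {}" | "{A. A \<subseteq> {..<d} \<and> \<gamma> A = y} = {{..<d}}" by blast
  then show ?thesis
  proof cases
    case 1
    show ?thesis unfolding eq 1 by simp
  next
    case 2
    show ?thesis unfolding eq 2 by (cases "even d") auto
  qed
qed

text \<open>If the join \<open>e\<close> of all atoms is below \<open>y\<close>, the maps \<open>w \<ge> \<gamma> (\<alpha> w) \<le> e\<close> contract the open interval.
Otherwise \<open>\<alpha>\<close> and \<open>\<gamma>\<close> restrict to the proper parts, and \<open>d \<ge> 2\<close> as soon as the open interval is
nonempty.\<close>

lemma open_interval_homotopy_type:
  "homotopic_to_sphere (order_realization r (open_interval r x y)) \<or>
   homotopic_to_point (order_realization r (open_interval r x y))"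
proof -
  let ?P = "open_interval r x y"
  have yy: "(y, y) \<in> r" using refl xy .
  have P: "w \<in> ?P \<longleftrightarrow> (x, w) \<in> r \<and> (w, y) \<in> r \<and> w \<noteq> x \<and> w \<noteq> y" for w by (simp add: open_interval_def)
  have finP: "finite ?P" by (rule finite_subset[OF _ fin]) (auto simp: P)
  have reflP: "(c, c) \<in> r" if "c \<in> ?P" for c using that refl P by blast
  have tr: "trans r" using order by (simp add: partial_order_on_def preorder_on_def)
  have alpha_ne: "\<alpha> w \<noteq> {}" if "w \<in> ?P" for w using that alpha_empty P by blast
  have below_P: "\<gamma> A \<in> ?P" if "A \<subseteq> {..<d}" "A \<noteq> {}" "\<gamma> A \<noteq> y" for A
    using that gamma_in gamma_eq_bottom P by blast
  show ?thesis
  proof (cases "?P = {}")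
    case True
    have "topspace (order_realization r {}) = {}"
      using in_order_realization_iff[of "{}" _ r] by (simp add: set_eq_iff del: null_topspace_iff_trivial)
    then show ?thesis by (simp add: True homotopic_to_sphere_def)
  next
    case nonempty: False
    show ?thesis
    proof (cases "\<gamma> {..<d} = y")
      case True
      have alpha_full: "\<alpha> w \<noteq> {..<d}" if "w \<in> ?P" for w
      proof
        assume "\<alpha> w = {..<d}"
        then have "(y, w) \<in> r" using gamma_alpha_le[of w] True that by (simp add: P)
        then show False using that antisym by (simp add: P) blast
      qed
      obtain w where w: "w \<in> ?P" using nonempty by blast
      have "2 \<le> d"
      proof (rule ccontr)
        assume "\<not> 2 \<le> d"
        then have "{..<d} \<subseteq> {0}" by auto
        moreover have "\<alpha> w \<subseteq> {..<d}" using alpha_sub w unfolding P by blast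
        ultimately show False using alpha_ne[OF w] alpha_full[OF w] by blast
      qed
      then obtain e where e: "d = Suc (Suc e)" by (metis add_2_eq_Suc le_Suc_ex)
      have d: "{..<d} = {..Suc e}" by (auto simp: e)
      let ?Q = "proper_subsets {..<d}"
      have "order_realization r ?P homotopy_equivalent_space order_realization subset_order ?Q"
      proof (rule homotopy_equivalent_Galois)
        show "mono_between r ?P subset_order ?Q \<alpha>"
          using alpha_sub alpha_ne alpha_full alpha_mono
          by (auto simp: mono_between_def proper_subsets_def subset_order_def P subset_iff)
        show "mono_between subset_order ?Q r ?P \<gamma>"
          using gamma_mono below_P only_full_joins_to_top
          by (auto simp: mono_between_def proper_subsets_def subset_order_def)
        show "(\<gamma> (\<alpha> c), c) \<in> r" if "c \<in> ?P" for c using that gamma_alpha_le P by blast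
        show "(c, \<alpha> (\<gamma> c)) \<in> subset_order" if "c \<in> ?Q" for c
          using that alpha_gamma_ge by (simp add: subset_order_def proper_subsets_def)
      qed (use finP reflP tr in
          \<open>auto simp: finite_proper_subsets subset_order_def trans_def\<close>)
      also have "order_realization subset_order ?Q homotopy_equivalent_space nsphere e"
        unfolding d by (intro homeomorphic_imp_homotopy_equivalent_space proper_subsets_homeomorphic_nsphere)
      finally show ?thesis unfolding homotopic_to_sphere_def by blast
    next
      case False
      have d: "{..<d} \<noteq> {}" using nonempty alpha_ne alpha_sub P by blast
      have gP: "\<gamma> (\<alpha> c) \<in> ?P" if "c \<in> ?P" for c
      proof (rule below_P)
        show "\<gamma> (\<alpha> c) \<noteq> y"
        proof
          assume "\<gamma> (\<alpha> c) = y"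
          then have "(y, c) \<in> r" using gamma_alpha_le[of c] that by (simp add: P)
          then show False using that antisym by (simp add: P) blast
        qed
        show "\<alpha> c \<subseteq> {..<d}" using that alpha_sub by (simp add: P)
        show "\<alpha> c \<noteq> {}" using alpha_ne[OF that] .
      qed
      have "homotopic_to_point (order_realization r ?P)"
      proof (rule homotopic_to_point_conical)
        show "mono_between r ?P r ?P (\<lambda>w. \<gamma> (\<alpha> w))"
          using gP gamma_mono alpha_mono alpha_sub by (auto simp: mono_between_def P)
        show "\<gamma> {..<d} \<in> ?P" using below_P[OF order_refl d False] .
        fix c assume "c \<in> ?P"
        then have c: "(x, c) \<in> r" "(c, y) \<in> r" by (simp_all add: P)
        show "(\<gamma> (\<alpha> c), c) \<in> r" using gamma_alpha_le[OF c] .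
        show "(\<gamma> (\<alpha> c), \<gamma> {..<d}) \<in> r" using gamma_mono[OF alpha_sub[OF c] order_refl] .
      qed (use finP reflP tr in auto)
      then show ?thesis by blast
    qed
  qed
qed

end

section \<open>Posets generated by height-raising steps\<close>

text \<open>The properties of the covering steps on which all order-theoretic arguments rest. The relation
\<open>step p x y\<close> stands for a partial function \<open>x \<mapsto> y\<close> for each position \<open>p\<close>; whether a step at \<open>p\<close> is
possible at \<open>x\<close> depends only on the heights up to \<open>p\<close>. The predicate \<open>tie x p q\<close> tells whether two
steps at \<open>q\<close> are needed in the commutation law \<open>swap\<close>, and it too depends only on the heights up to
\<open>q\<close>, hence is not changed by steps further to the right.\<close>

locale step_system =
  fixes r :: "'a rel" and step :: "nat \<Rightarrow> 'a \<Rightarrow> 'a \<Rightarrow> bool"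
    and ht :: "'a \<Rightarrow> nat \<Rightarrow> nat" and tie :: "'a \<Rightarrow> nat \<Rightarrow> nat \<Rightarrow> bool"
  assumes order: "Partial_order r"
    and fin: "finite (Field r)"
    and r_iff: "(x, y) \<in> r \<longleftrightarrow> x \<in> Field r \<and> (\<lambda>u v. \<exists>p. step p u v)\<^sup>*\<^sup>* x y"
    and step_in: "step p x y \<Longrightarrow> x \<in> Field r \<and> y \<in> Field r"
    and ht_eqI: "x \<in> Field r \<Longrightarrow> y \<in> Field r \<Longrightarrow> ht x = ht y \<Longrightarrow> x = y"
    and step_below: "step p x y \<Longrightarrow> j < p \<Longrightarrow> ht y j = ht x j"
    and step_at: "step p x y \<Longrightarrow> ht y p = Suc (ht x p)"
    and step_ge: "step p x y \<Longrightarrow> ht x j \<le> ht y j"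
    and step_fun: "step p x y \<Longrightarrow> step p x y' \<Longrightarrow> y = y'"
    and step_inj: "step p x z \<Longrightarrow> step p y z \<Longrightarrow> x = y"
    and step_transfer: "step p x x' \<Longrightarrow> y \<in> Field r \<Longrightarrow> (\<And>j. j \<le> p \<Longrightarrow> ht y j = ht x j) \<Longrightarrow> \<exists>y'. step p y y'"
    and tie_transfer: "p < q \<Longrightarrow> tie x p q \<Longrightarrow> (\<And>j. j \<le> q \<Longrightarrow> ht y j = ht x j) \<Longrightarrow> tie y p q"
    and swap: "p < q \<Longrightarrow> step p x u \<Longrightarrow> step q x v \<Longrightarrow> step p v w \<Longrightarrow>
      (if tie x p q then \<exists>u'. step q u u' \<and> step q u' w else step q u w)"
begin

lemma refl: "x \<in> Field r \<Longrightarrow> (x, x) \<in> r"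
  using order by (auto simp: partial_order_on_def preorder_on_def refl_on_def)

lemma trans [trans]: "(x, y) \<in> r \<Longrightarrow> (y, z) \<in> r \<Longrightarrow> (x, z) \<in> r"
  using order by (auto simp: partial_order_on_def preorder_on_def dest: transD)

lemma antisym: "(x, y) \<in> r \<Longrightarrow> (y, x) \<in> r \<Longrightarrow> x = y"
  using order by (auto simp: partial_order_on_def dest: antisymD)

lemma step_le: "step p x y \<Longrightarrow> (x, y) \<in> r"
  using step_in unfolding r_iff by blast

lemma swap_le:
  assumes "p < q" "step p x u" "step q x v" "step p v w"
  shows "(u, w) \<in> r"
proof (cases "tie x p q")
  case True
  then obtain u' where "step q u u'" "step q u' w" using swap[OF assms] by auto
  then show ?thesis using step_le trans by blast
next
  case False
  then show ?thesis using swap[OF assms] step_le by simp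
qed

lemma le_induct [consumes 1, case_names base step]:
  assumes "(x, y) \<in> r"
    and "y \<in> Field r \<Longrightarrow> P y"
    and "\<And>p x x'. step p x x' \<Longrightarrow> (x', y) \<in> r \<Longrightarrow> P x' \<Longrightarrow> P x"
  shows "P x"
proof -
  have y: "y \<in> Field r" using assms(1) by (rule FieldI2)
  have "(\<lambda>u v. \<exists>p. step p u v)\<^sup>*\<^sup>* x y" using assms(1) r_iff by blast
  then show ?thesis
  proof (induction rule: converse_rtranclp_induct)
    case base then show ?case using assms(2) y by blast
  next
    case (step x x')
    then obtain p where "step p x x'" by blast
    moreover from this have "(x', y) \<in> r" using step.hyps(2) step_in unfolding r_iff by blast
    ultimately show ?case using assms(3) step.IH by blast
  qed
qed

lemma le_cases [consumes 1, case_names base step]: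
  assumes "(x, y) \<in> r"
  obtains "x = y" | p x' where "step p x x'" "(x', y) \<in> r"
  using assms
  by (induction rule: le_induct) auto

lemma ht_mono: "(x, y) \<in> r \<Longrightarrow> ht x j \<le> ht y j"
  by (induction rule: le_induct) (auto dest: step_ge[of _ _ _ j])

lemma step_neq: "step p x y \<Longrightarrow> x \<noteq> y"
  using step_at by fastforce

definition agree :: "'a \<Rightarrow> 'a \<Rightarrow> nat \<Rightarrow> bool" where
  "agree x y p \<longleftrightarrow> (\<forall>j<p. ht x j = ht y j)"

lemma first_difference:
  assumes "(x, y) \<in> r" "x \<noteq> y"
  obtains p where "agree x y p" "ht x p < ht y p"
proof -
  define p where "p = (LEAST j. ht x j \<noteq> ht y j)"
  have "\<exists>j. ht x j \<noteq> ht y j" using ht_eqI[of x y] assms by (auto intro: FieldI1 FieldI2)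
  then have "ht x p \<noteq> ht y p" unfolding p_def by (rule LeastI_ex)
  moreover have "agree x y p" unfolding agree_def p_def using not_less_Least by blast
  ultimately show ?thesis using that ht_mono[OF assms(1), of p] by simp
qed

lemma agree_between:
  "(x, u) \<in> r \<Longrightarrow> (u, y) \<in> r \<Longrightarrow> agree x y p \<Longrightarrow> agree x u p \<and> agree u y p"
  unfolding agree_def using ht_mono by (metis order_antisym)

lemma step_position:
  assumes "step q x x'" "(x', y) \<in> r" "agree x y p"
  shows "p \<le> q"
  using step_at[OF assms(1)] ht_mono[OF assms(2), of q] assms(3) by (fastforce simp: agree_def not_le[symmetric])

lemma step_agree: "step q x x' \<Longrightarrow> agree x x' q"
  by (simp add: agree_def step_below)

lemma step_ex:
  assumes "step p x x'" "y \<in> Field r" "agree x y (Suc p)"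
  obtains y' where "step p y y'"
  using step_transfer[OF assms(1,2)] assms(3) by (auto simp: agree_def)

text \<open>Along a path from \<open>x\<close> to \<open>y\<close> all steps are at positions \<open>\<ge> p\<close>. A step at \<open>q > p\<close> in front of the first
step at \<open>p\<close> can be exchanged with it, so that the step at \<open>p\<close> moves to the front.\<close>

lemma step_first_difference:
  assumes "(x, y) \<in> r" "agree x y p" "ht x p < ht y p"
  obtains z where "step p x z" "(z, y) \<in> r"
proof -
  have "\<exists>z. step p x z \<and> (z, y) \<in> r" using assms
  proof (induction rule: le_induct)
    case base then show ?case by simp
  next
    case (step q x x')
    have "p \<le> q" using step_position step by blast
    show ?case
    proof (cases "p = q")
      case False
      then have pq: "p < q" using \<open>p \<le> q\<close> by simp
      then have ag: "agree x' x (Suc p)" using step_agree[OF step.hyps(1)] by (simp add: agree_def)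
      then obtain z' where z': "step p x' z'" "(z', y) \<in> r"
        using step.IH step.prems by (auto simp: agree_def)
      obtain z where z: "step p x z" using step_ex[OF z'(1) _ ag] step_in[OF step.hyps(1)] by blast
      have "(z, z') \<in> r"
        using swap_le[OF pq z step.hyps(1) z'(1)] .
      then show ?thesis using z z'(2) trans by blast
    qed (use step in blast)
  qed
  then show ?thesis using that by blast
qed

lemma step_mono:
  assumes "(x, y) \<in> r" "agree x y (Suc p)" "step p x x'" "step p y y'"
  shows "(x', y') \<in> r"
  using assms
proof (induction arbitrary: x' rule: le_induct)
  case base then show ?case using step_fun step_in FieldI1 refl by metis
next
  case (step q x u)
  have q: "p < q" using step_position[OF step.hyps(1,2) step.prems(1)] by simp
  have ag: "agree x u (Suc p)" using step_agree[OF step.hyps(1)] q by (simp add: agree_def)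
  obtain u' where u': "step p u u'" using step_ex[OF step.prems(2) _ ag] step_in[OF step.hyps(1)] by blast
  have "(x', u') \<in> r"
    using swap_le[OF q step.prems(2) step.hyps(1) u'] .
  moreover have "(u', y') \<in> r"
    using step.IH[OF _ u' step.prems(3)] ag step.prems(1) by (simp add: agree_def)
  ultimately show ?case by (rule trans)
qed

definition above :: "'a \<Rightarrow> 'a set" where "above x = {z. (x, z) \<in> r}"

lemma finite_above: "finite (above x)"
  unfolding above_def using fin by (rule rev_finite_subset) (auto intro: FieldI2)

lemma card_above_less:
  assumes "(x, y) \<in> r" "x \<noteq> y" shows "card (above y) < card (above x)"
proof (rule psubset_card_mono[OF finite_above])
  show "above y \<subset> above x"
    unfolding above_def using assms trans antisym refl FieldI1[OF assms(1)] by blast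
qed

lemma up_induct [case_names less]:
  assumes "\<And>x. (\<And>y. (x, y) \<in> r \<Longrightarrow> x \<noteq> y \<Longrightarrow> P y) \<Longrightarrow> P x"
  shows "P x"
  by (induction "card (above x)" arbitrary: x rule: less_induct) (use assms card_above_less in blast)

definition below :: "'a \<Rightarrow> 'a set" where "below x = {z. (z, x) \<in> r}"

lemma down_induct [case_names less]:
  assumes "\<And>x. (\<And>y. (y, x) \<in> r \<Longrightarrow> x \<noteq> y \<Longrightarrow> P y) \<Longrightarrow> P x"
  shows "P x"
proof (induction "card (below x)" arbitrary: x rule: less_induct)
  case less
  show ?case
  proof (rule assms)
    fix y assume y: "(y, x) \<in> r" "x \<noteq> y"
    have "below y \<subset> below x"
      unfolding below_def using y trans antisym refl FieldI2[OF y(1)] by blast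
    moreover have "finite (below x)"
      unfolding below_def using fin by (rule rev_finite_subset) (auto intro: FieldI1)
    ultimately show "P y" using less psubset_card_mono by blast
  qed
qed

text \<open>If the steps at \<open>q\<close> from \<open>x\<close> and some \<open>v \<ge> x\<close> with the same heights up to \<open>q\<close> are below \<open>w\<close>, then so is
the step at \<open>q\<close> from \<open>v\<close>; in other words, that step is the join of the two. By induction it suffices
to treat a single step from \<open>x\<close> to \<open>v\<^sub>1\<close>, at a position \<open>s > q\<close>. If \<open>q\<close> is the first difference of \<open>x\<close>
and \<open>w\<close>, this is \<open>step_first_difference\<close>. Otherwise the first difference is some \<open>p < q\<close>; the whole
configuration is pushed up by a step at \<open>p\<close>, which stays below \<open>w\<close>, and the induction hypothesis
applies at the element \<open>x'\<close> reached by it from \<open>x\<close>. When \<open>p\<close> and \<open>q\<close> tie, the step at \<open>q\<close> is doubled by this, and the hypothesis is used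
twice.\<close>

lemma step_join:
  assumes "step q x u" "(u, w) \<in> r" "(x, v) \<in> r" "(v, w) \<in> r" "agree x v (Suc q)" "step q v t"
  shows "(t, w) \<in> r"
  using assms
proof (induction x arbitrary: q u v t rule: up_induct)
  case (less x)
  from less.prems(3) show ?case
  proof (cases rule: le_cases)
    case base
    then show ?thesis using less.prems step_fun by blast
  next
    case (step s v1)
    have qs: "q < s" using step_position[OF step less.prems(5)] by simp
    have v1: "(v1, w) \<in> r" "v1 \<in> Field r" using step less.prems(4) trans step_in by blast+
    have ag1: "agree x v1 (Suc q)" using step_agree[OF step(1)] qs by (simp add: agree_def)
    obtain t1 where t1: "step q v1 t1" using step_ex[OF less.prems(1) v1(2) ag1] .
    have xw: "(x, w) \<in> r" using less.prems trans by blast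
    have "ht x q < ht w q" using step_at[OF less.prems(1)] ht_mono[OF less.prems(2), of q] by simp
    then have "x \<noteq> w" by auto
    then obtain p where p: "agree x w p" "ht x p < ht w p" using first_difference[OF xw] by blast
    have pq: "p \<le> q" using step_position[OF less.prems(1,2) p(1)] .
    have pv: "agree v1 w p" "ht v1 p < ht w p"
      using p ag1 pq by (simp_all add: agree_def)
    have "(t1, w) \<in> r"
    proof (cases "p = q")
      case True
      then show ?thesis using step_first_difference[OF v1(1) pv] step_fun t1 by metis
    next
      case False
      then have pq: "p < q" using pq by simp
      obtain x' where x': "step p x x'" "(x', w) \<in> r" using step_first_difference[OF xw p] .
      obtain v1' where v1': "step p v1 v1'" "(v1', w) \<in> r" using step_first_difference[OF v1(1) pv] .
      have "agree u w p" "ht u p < ht w p"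
        using p step_agree[OF less.prems(1)] pq by (simp_all add: agree_def)
      then obtain u' where u': "step p u u'" "(u', w) \<in> r" using step_first_difference[OF less.prems(2)] by blast
      have "agree v1 t1 (Suc p)" using step_agree[OF t1] pq by (simp add: agree_def)
      then obtain t' where t': "step p t1 t'" using step_ex[OF v1'(1)] step_in[OF t1] by blast
      have tie: "tie v1 p q \<longleftrightarrow> tie x p q"
        using tie_transfer[OF pq, of x v1] tie_transfer[OF pq, of v1 x] ag1 by (auto simp: agree_def)
      \<comment> \<open>Pushed up by the step at \<open>p\<close>, the path from \<open>x\<close> to \<open>v\<^sub>1\<close> still uses only position \<open>s > q\<close>.\<close>
      have ag': "agree x' v1' (Suc q)" and x'v1': "(x', v1') \<in> r"
      proof -
        have "p < s" using pq qs by simp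
        from swap[OF this x'(1) step(1) v1'(1)]
        consider "step s x' v1'" | c where "step s x' c" "step s c v1'" by (auto split: if_splits)
        then have "agree x' v1' s \<and> (x', v1') \<in> r"
        proof cases
          case 2
          then show ?thesis
            using step_agree[OF 2(1)] step_agree[OF 2(2)] step_le[OF 2(1)] step_le[OF 2(2)] trans
            by (auto simp: agree_def)
        qed (use step_agree step_le in blast)
        then show "agree x' v1' (Suc q)" "(x', v1') \<in> r" using qs by (auto simp: agree_def)
      qed
      have x'_ne: "(x, x') \<in> r" "x \<noteq> x'" using x'(1) step_le step_neq by blast+
      have "(t', w) \<in> r"
      proof (cases "tie x p q")
        case False
        have "step q x' u'" using swap[OF pq x'(1) less.prems(1) u'(1)] False by simp
        moreover have "step q v1' t'" using swap[OF pq v1'(1) t1 t'] False tie by simp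
        ultimately show ?thesis using less.IH[OF x'_ne _ u'(2) x'v1' v1'(2) ag'] by blast
      next
        case True
        obtain x2 where x2: "step q x' x2" "step q x2 u'"
          using swap[OF pq x'(1) less.prems(1) u'(1)] True by auto
        obtain t2 where t2: "step q v1' t2" "step q t2 t'" using swap[OF pq v1'(1) t1 t'] True tie by auto
        have "(x2, w) \<in> r" using step_le[OF x2(2)] u'(2) trans by blast
        then have t2w: "(t2, w) \<in> r" using less.IH[OF x'_ne x2(1) _ x'v1' v1'(2) ag' t2(1)] by blast
        have x2t2: "(x2, t2) \<in> r" using step_mono[OF x'v1' ag' x2(1) t2(1)] .
        have "agree x2 t2 (Suc q)"
          using ag' step_agree[OF x2(1)] step_agree[OF t2(1)] step_at[OF x2(1)] step_at[OF t2(1)]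
          by (auto simp: agree_def less_Suc_eq)
        moreover have "(x, x2) \<in> r" "x \<noteq> x2"
          using x'_ne step_le[OF x2(1)] trans antisym by blast+
        ultimately show ?thesis using less.IH[OF _ _ x2(2) u'(2) x2t2 t2w _ t2(2)] by blast
      qed
      then show ?thesis using step_le[OF t'] trans by blast
    qed
    moreover have "agree v1 v (Suc q)" using ag1 less.prems(5) by (simp add: agree_def)
    moreover have "(x, v1) \<in> r" "x \<noteq> v1" using step step_le step_neq by blast+
    ultimately show ?thesis using less.IH[OF _ _ t1 _ step(2) less.prems(4) _ less.prems(6)] by blast
  qed
qed

text \<open>By \<open>step_join\<close> the steps inside the set \<open>E\<close> of candidates are locally confluent, and \<open>E\<close> is finite and
convex. As in Newman's lemma, every element of \<open>E\<close>, in particular \<open>x\<close>, therefore has a greatest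
element of \<open>E\<close> above it.\<close>

lemma greatest_with_same_height:
  assumes "(x, w) \<in> r" "agree x w p"
  obtains c where "(x, c) \<in> r" "(c, w) \<in> r" "ht c p = ht x p"
    "\<And>v. (x, v) \<in> r \<Longrightarrow> (v, w) \<in> r \<Longrightarrow> ht v p = ht x p \<Longrightarrow> (v, c) \<in> r"
proof -
  define E where "E = {v. (x, v) \<in> r \<and> (v, w) \<in> r \<and> ht v p = ht x p}"
  have agE: "agree u v (Suc p)" if "u \<in> E" "v \<in> E" for u v
  proof -
    have "ht z j = ht x j" if "z \<in> E" "j \<le> p" for z j
    proof -
      have z: "(x, z) \<in> r" "(z, w) \<in> r" "ht z p = ht x p" using that(1) by (simp_all add: E_def)
      have "agree x z p" using agree_between[OF z(1,2) assms(2)] by simp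
      then show ?thesis using that(2) z(3) by (cases "j = p") (simp_all add: agree_def)
    qed
    then show ?thesis using that by (simp add: agree_def)
  qed
  have conv: "v \<in> E" if "u \<in> E" "(u, v) \<in> r" "(v, z) \<in> r" "z \<in> E" for u v z
  proof -
    have "(x, v) \<in> r" "(v, w) \<in> r" using that trans unfolding E_def by blast+
    moreover have "ht v p = ht x p"
      using ht_mono[OF that(2), of p] ht_mono[OF that(3), of p] that(1,4) by (simp add: E_def)
    ultimately show ?thesis by (simp add: E_def)
  qed
  have join: "\<exists>j\<in>E. (u1, j) \<in> r \<and> (u2, j) \<in> r"
    if h: "u \<in> E" "u1 \<in> E" "u2 \<in> E" "step q u u1" "step s u u2" "q < s" for u u1 u2 q s
  proof -
    have ag: "agree u u2 (Suc q)" using step_agree[OF h(5)] h(6) by (simp add: agree_def)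
    obtain j where j: "step q u2 j" using step_ex[OF h(4) _ ag] step_in[OF h(5)] by blast
    have "(j, w) \<in> r"
      using step_join[OF h(4) _ step_le[OF h(5)] _ ag j] h by (auto simp: E_def)
    moreover have "Suc p \<le> q" using step_position[OF h(4) _ agE[OF h(1,2)]] refl step_in[OF h(4)] by blast
    then have "ht j p = ht u2 p" using step_below[OF j] by simp
    moreover have "(x, j) \<in> r" using h(3) step_le[OF j] trans unfolding E_def by blast
    ultimately have "j \<in> E" using h(3) by (simp add: E_def)
    then show ?thesis using step_le[OF j] step_mono[OF step_le[OF h(5)] ag h(4) j] by blast
  qed
  have join': "\<exists>j\<in>E. (u1, j) \<in> r \<and> (u2, j) \<in> r"
    if "u \<in> E" "u1 \<in> E" "u2 \<in> E" "step q u u1" "step s u u2" for u u1 u2 q s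
  proof (cases q s rule: linorder_cases)
    case equal
    then show ?thesis using that step_fun refl step_in by metis
  qed (use join[OF that] join[OF that(1,3,2,5,4)] in blast)+
  have "\<exists>M\<in>E. (u, M) \<in> r \<and> (\<forall>v\<in>E. (u, v) \<in> r \<longrightarrow> (v, M) \<in> r)" if "u \<in> E" for u
    using that
  proof (induction u rule: up_induct)
    case (less u)
    show ?case
    proof (cases "\<exists>q u1. step q u u1 \<and> u1 \<in> E")
      case False
      have "v = u" if "v \<in> E" "(u, v) \<in> r" for v
        using that(2)
      proof (cases rule: le_cases)
        case (step q u1)
        then show ?thesis using conv[OF less.prems step_le[OF step(1)] step(2) that(1)] False by blast
      qed simp
      then show ?thesis using less.prems refl by (metis (mono_tags, lifting) E_def FieldI2 mem_Collect_eq)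
    next
      case True
      then obtain q u1 where u1: "step q u u1" "u1 \<in> E" by blast
      then obtain M where M: "M \<in> E" "(u1, M) \<in> r" "\<And>v. v \<in> E \<Longrightarrow> (u1, v) \<in> r \<Longrightarrow> (v, M) \<in> r"
        using less.IH[OF step_le step_neq] by blast
      have uM: "(u, M) \<in> r" using step_le[OF u1(1)] M(2) trans by blast
      have "(v, M) \<in> r" if v: "v \<in> E" "(u, v) \<in> r" for v
        using v(2)
      proof (cases rule: le_cases)
        case base
        then show ?thesis using uM by simp
      next
        case (step s u2)
        have u2: "u2 \<in> E" using conv[OF less.prems step_le[OF step(1)] step(2) v(1)] .
        then obtain M2 where M2: "M2 \<in> E" "\<And>v. v \<in> E \<Longrightarrow> (u2, v) \<in> r \<Longrightarrow> (v, M2) \<in> r"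
          using less.IH[OF step_le step_neq] step(1) by blast
        obtain j where j: "j \<in> E" "(u1, j) \<in> r" "(u2, j) \<in> r"
          using join'[OF less.prems u1(2) u2 u1(1) step(1)] by blast
        have "(u2, M) \<in> r" using M(3)[OF j(1,2)] j(3) trans by blast
        then have 1: "(M, M2) \<in> r" using M2 M by blast
        have "(u1, M2) \<in> r" using M(2) 1 trans by blast
        then have "M = M2" using M(3)[OF M2(1)] 1 antisym by blast
        then show ?thesis using M2(2)[OF v(1) step(2)] by simp
      qed
      then show ?thesis using M(1) uM by blast
    qed
  qed
  moreover have "x \<in> E" using assms(1) refl[of x] by (auto simp: E_def intro: FieldI1)
  ultimately obtain M where M: "M \<in> E" "\<And>v. v \<in> E \<Longrightarrow> (x, v) \<in> r \<Longrightarrow> (v, M) \<in> r" by blast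
  show ?thesis by (rule that[of M]) (use M in \<open>auto simp: E_def\<close>)
qed

text \<open>Induction on \<open>y\<close>. With \<open>p\<close> the first difference of \<open>x\<close> and \<open>y\<close>, let \<open>\<kappa> w\<close> be the greatest element of
\<open>[x, w]\<close> with the same height at \<open>p\<close> as \<open>x\<close>, and \<open>c = \<kappa> y\<close>. The map \<open>\<kappa>\<close> is right adjoint to the inclusion
of \<open>[x, c]\<close> into \<open>[x, y]\<close>, so the model of \<open>[x, c]\<close> extends along it. The new index \<open>d\<close> stands for the
atom reached by the step at \<open>p\<close>: an element of \<open>[x, y]\<close> is above it if and only if its height at \<open>p\<close>
exceeds that of \<open>x\<close>, and the join of it with an element of \<open>[x, c]\<close> is the step at \<open>p\<close> from there.
Irredundancy is inherited because steps at \<open>p\<close> are injective.\<close>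

theorem boolean_model_exists:
  assumes "(x, y) \<in> r"
  shows "\<exists>d \<alpha> \<gamma>. boolean_model r x y d \<alpha> \<gamma>"
  using assms
proof (induction y rule: down_induct)
  case (less y)
  have finI: "finite {w. (x, w) \<in> r \<and> (w, y) \<in> r}"
    using finite_above[of x] by (rule rev_finite_subset) (auto simp: above_def)
  have xF: "x \<in> Field r" using less.prems by (rule FieldI1)
  show ?case
  proof (cases "x = y")
    case True
    then have "boolean_model r x y 0 (\<lambda>_. {}) (\<lambda>_. x)"
      using order finI less.prems refl[OF xF] antisym by unfold_locales auto
    then show ?thesis by blast
  next
    case False
    obtain p where p: "agree x y p" "ht x p < ht y p" using first_difference[OF less.prems False] .
    \<comment> \<open>\<open>D w\<close> consists of the elements of \<open>[x, w]\<close> that are not above the atom at \<open>p\<close>.\<close>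
    define D where "D w = {v. (x, v) \<in> r \<and> (v, w) \<in> r \<and> ht v p = ht x p}" for w
    have "\<exists>c\<in>D w. \<forall>v\<in>D w. (v, c) \<in> r" if w: "(x, w) \<in> r" "(w, y) \<in> r" for w
    proof -
      have "agree x w p" using agree_between[OF w p(1)] by simp
      then obtain c where "(x, c) \<in> r" "(c, w) \<in> r" "ht c p = ht x p"
        "\<And>v. (x, v) \<in> r \<Longrightarrow> (v, w) \<in> r \<Longrightarrow> ht v p = ht x p \<Longrightarrow> (v, c) \<in> r"
        using greatest_with_same_height[OF w(1)] by metis
      then show ?thesis by (intro bexI[of _ c] ballI) (simp_all add: D_def)
    qed
    then have "\<forall>w. \<exists>c. (x, w) \<in> r \<and> (w, y) \<in> r \<longrightarrow> c \<in> D w \<and> (\<forall>v\<in>D w. (v, c) \<in> r)" by blast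
    then obtain \<kappa> where \<kappa>: "\<And>w. (x, w) \<in> r \<Longrightarrow> (w, y) \<in> r \<Longrightarrow> \<kappa> w \<in> D w"
      "\<And>w v. (x, w) \<in> r \<Longrightarrow> (w, y) \<in> r \<Longrightarrow> v \<in> D w \<Longrightarrow> (v, \<kappa> w) \<in> r"
      unfolding choice_iff by blast
    have yy: "(y, y) \<in> r" using refl less.prems FieldI2 by metis
    define c where "c = \<kappa> y"
    have c: "(x, c) \<in> r" "(c, y) \<in> r" "ht c p = ht x p"
      using \<kappa>(1)[OF less.prems yy] by (auto simp: c_def D_def)
    have "y \<noteq> c" using c(3) p(2) by auto
    then obtain d \<alpha> \<gamma> where "boolean_model r x c d \<alpha> \<gamma>" using less.IH[OF c(2) _ c(1)] by blast
    then interpret M: boolean_model r x c d \<alpha> \<gamma> .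
    have le_c: "(v, c) \<in> r" if "(x, v) \<in> r" "(v, y) \<in> r" "ht v p = ht x p" for v
      using \<kappa>(2)[OF less.prems yy, of v] that by (simp add: D_def c_def)
    have ht_p: "ht v p = ht x p" if "(x, v) \<in> r" "(v, c) \<in> r" for v
      using ht_mono[OF that(1), of p] ht_mono[OF that(2), of p] c(3) by simp
    have kap: "(x, \<kappa> w) \<in> r" "(\<kappa> w, w) \<in> r" "ht (\<kappa> w) p = ht x p" "(\<kappa> w, c) \<in> r"
      if "(x, w) \<in> r" "(w, y) \<in> r" for w
    proof -
      show *: "(x, \<kappa> w) \<in> r" "(\<kappa> w, w) \<in> r" "ht (\<kappa> w) p = ht x p"
        using \<kappa>(1)[OF that] by (simp_all add: D_def)
      show "(\<kappa> w, c) \<in> r" using le_c[OF *(1) trans[OF *(2) that(2)] *(3)] .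
    qed
    have kap_iff: "(v, \<kappa> w) \<in> r \<longleftrightarrow> (v, w) \<in> r"
      if "(x, w) \<in> r" "(w, y) \<in> r" "(x, v) \<in> r" "(v, c) \<in> r" for v w
      using \<kappa>(2)[OF that(1,2), of v] kap(2)[OF that(1,2)] trans that(3) ht_p[OF that(3,4)]
      by (auto simp: D_def)
    \<comment> \<open>The join of \<open>v\<close> with the atom at \<open>p\<close>, within \<open>[x, y]\<close>, is a single step.\<close>
    have "\<exists>w. step p v w \<and> (w, y) \<in> r \<and>
        (\<forall>u. (u, y) \<in> r \<longrightarrow> (v, u) \<in> r \<longrightarrow> ht x p < ht u p \<longrightarrow> (w, u) \<in> r)"
      if v: "(x, v) \<in> r" "(v, c) \<in> r" for v
    proof -
      have vy: "(v, y) \<in> r" using v(2) c(2) by (rule trans)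
      have ag: "agree v y p" using agree_between[OF v(1) vy p(1)] by simp
      obtain w where w: "step p v w" "(w, y) \<in> r"
        using step_first_difference[OF vy ag] p(2) ht_p[OF v] by auto
      have "(w, u) \<in> r" if u: "(u, y) \<in> r" "(v, u) \<in> r" "ht x p < ht u p" for u
        using step_first_difference[OF u(2), of p] agree_between[OF u(2,1) ag] u(3) step_fun[OF w(1)]
          ht_p[OF v] by metis
      then show ?thesis using w by blast
    qed
    then have "\<forall>v. \<exists>w. (x, v) \<in> r \<and> (v, c) \<in> r \<longrightarrow> step p v w \<and> (w, y) \<in> r \<and>
        (\<forall>u. (u, y) \<in> r \<longrightarrow> (v, u) \<in> r \<longrightarrow> ht x p < ht u p \<longrightarrow> (w, u) \<in> r)" by blast
    then obtain J where J: "\<And>v. (x, v) \<in> r \<Longrightarrow> (v, c) \<in> r \<Longrightarrow> step p v (J v)"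
      "\<And>v. (x, v) \<in> r \<Longrightarrow> (v, c) \<in> r \<Longrightarrow> (J v, y) \<in> r"
      "\<And>v u. (x, v) \<in> r \<Longrightarrow> (v, c) \<in> r \<Longrightarrow> (u, y) \<in> r \<Longrightarrow> (v, u) \<in> r \<Longrightarrow> ht x p < ht u p \<Longrightarrow> (J v, u) \<in> r"
      unfolding choice_iff by blast
    have J_iff: "(J v, w) \<in> r \<longleftrightarrow> (v, w) \<in> r \<and> ht x p < ht w p"
      if "(x, v) \<in> r" "(v, c) \<in> r" "(w, y) \<in> r" for v w
      using J(3)[OF that] step_le[OF J(1)[OF that(1,2)]] trans step_at[OF J(1)[OF that(1,2)]]
        ht_p[OF that(1,2)] ht_mono[of "J v" w p] by (metis Suc_le_lessD)
    define \<alpha>' where "\<alpha>' w = \<alpha> (\<kappa> w) \<union> (if ht x p < ht w p then {d} else {})" for w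
    define \<gamma>' where "\<gamma>' A = (if d \<in> A then J (\<gamma> (A - {d})) else \<gamma> A)" for A
    have sub: "A - {d} \<subseteq> {..<d}" if "A \<subseteq> {..<Suc d}" for A
      using that by (auto simp: less_Suc_eq)
    have g_in: "(x, \<gamma> (A - {d})) \<in> r" "(\<gamma> (A - {d}), c) \<in> r" if "A \<subseteq> {..<Suc d}" for A
      using M.gamma_in[OF sub[OF that]] by simp_all
    have "boolean_model r x y (Suc d) \<alpha>' \<gamma>'"
    proof
      show "Partial_order r" by (rule order)
      show "finite {w. (x, w) \<in> r \<and> (w, y) \<in> r}" by (rule finI)
      show "(x, y) \<in> r" by (rule less.prems)
    next
      fix w assume w: "(x, w) \<in> r" "(w, y) \<in> r"
      have ak: "\<alpha> (\<kappa> w) \<subseteq> {..<d}" using M.alpha_sub kap[OF w] by blast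
      then show "\<alpha>' w \<subseteq> {..<Suc d}" by (auto simp: \<alpha>'_def)
      have "\<kappa> w = w" if "\<not> ht x p < ht w p"
      proof -
        have "ht w p = ht x p" using that ht_mono[OF w(1), of p] by simp
        moreover have "(w, w) \<in> r" using w(1) by (intro refl FieldI2)
        ultimately have "(w, \<kappa> w) \<in> r" using \<kappa>(2)[OF w, of w] w by (simp add: D_def)
        then show ?thesis using kap(2)[OF w] antisym by blast
      qed
      moreover have "\<not> ht x p < ht w p" if "w = x" using that by simp
      ultimately show "\<alpha>' w = {} \<longleftrightarrow> w = x"
        using M.alpha_empty[OF kap(1,4)[OF w]] by (auto simp: \<alpha>'_def)
      fix A assume A: "A \<subseteq> {..<Suc d}"
      have *: "(\<gamma> (A - {d}), w) \<in> r \<longleftrightarrow> A - {d} \<subseteq> \<alpha> (\<kappa> w)"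
        using M.Galois[OF sub[OF A] kap(1,4)[OF w]] kap_iff[OF w g_in[OF A]] by simp
      show "(\<gamma>' A, w) \<in> r \<longleftrightarrow> A \<subseteq> \<alpha>' w"
      proof (cases "d \<in> A")
        case True
        then show ?thesis using * J_iff[OF g_in[OF A] w(2)] ak by (auto simp: \<gamma>'_def \<alpha>'_def)
      next
        case False
        then have "A - {d} = A" by simp
        then show ?thesis using * False ak by (auto simp: \<gamma>'_def \<alpha>'_def)
      qed
    next
      fix A assume A: "A \<subseteq> {..<Suc d}"
      note g = g_in[OF A]
      show "(x, \<gamma>' A) \<in> r \<and> (\<gamma>' A, y) \<in> r"
      proof (cases "d \<in> A")
        case True
        then show ?thesis using J(2)[OF g] step_le[OF J(1)[OF g]] trans[OF g(1)] by (simp add: \<gamma>'_def)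
      next
        case False
        then have "A - {d} = A" by simp
        then show ?thesis using g False trans[OF g(2) c(2)] by (simp add: \<gamma>'_def)
      qed
      assume eq: "\<gamma>' A = \<gamma>' {..<Suc d}"
      have full: "{..<Suc d} - {d} = {..<d}" by auto
      note g' = g_in[OF order_refl, unfolded full]
      have top: "\<gamma>' {..<Suc d} = J (\<gamma> {..<d})" by (simp add: \<gamma>'_def full)
      have "ht (\<gamma>' A) p = Suc (ht x p)"
        using step_at[OF J(1)[OF g']] ht_p[OF g'] by (simp add: eq top)
      then have dA: "d \<in> A"
        using ht_p[OF g] by (cases "d \<in> A") (auto simp: \<gamma>'_def)
      then have "J (\<gamma> (A - {d})) = J (\<gamma> {..<d})" using eq top by (simp add: \<gamma>'_def)
      then have "\<gamma> (A - {d}) = \<gamma> {..<d}" using step_inj J(1)[OF g] J(1)[OF g'] by metis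
      then have "A - {d} = {..<d}" using M.gamma_full[OF sub[OF A]] by blast
      then have "A = insert d {..<d}" using dA by blast
      then show "A = {..<Suc d}" by (simp add: lessThan_Suc)
    qed
    then show ?thesis by blast
  qed
qed

end

section \<open>Labeling steps by position and height\<close>

context step_system
begin

text \<open>A step \<open>x \<rightarrow> y\<close> at \<open>p\<close> is a covering: if \<open>x \<le> z < y\<close>, then \<open>z\<close> has the same height at \<open>p\<close> as \<open>x\<close>, for
otherwise \<open>y \<le> z\<close> by \<open>step_first_difference\<close>. So the step at \<open>p\<close> from \<open>z\<close> is both below \<open>y\<close> and, by
monotonicity, above \<open>y\<close>, and \<open>z = x\<close> by injectivity.\<close>

lemma covering_relations_eq: "covering_relations r = {(x, y). \<exists>p. step p x y}"
proof (intro equalityI subsetI; clarify)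
  fix x y assume "(x, y) \<in> covering_relations r"
  then have xy: "(x, y) \<in> r" "x \<noteq> y" and cov: "\<And>z. (x, z) \<in> r \<Longrightarrow> (z, y) \<in> r \<Longrightarrow> z = x \<or> z = y"
    by (auto simp: covering_relations_def)
  from xy(1) show "\<exists>p. step p x y"
  proof (cases rule: le_cases)
    case (step p z)
    then show ?thesis using cov[OF step_le[OF step(1)] step(2)] step_neq by blast
  qed (use xy in blast)
next
  fix x y p assume st: "step p x y"
  have "z = x \<or> z = y" if z: "(x, z) \<in> r" "(z, y) \<in> r" for z
  proof (rule disjCI)
    assume "z \<noteq> y"
    have ag: "agree x z p" "agree z y p" using agree_between[OF z step_agree[OF st]] by auto
    have "ht z p = ht x p"
    proof (rule ccontr)
      assume "ht z p \<noteq> ht x p"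
      then have "ht x p < ht z p" using ht_mono[OF z(1), of p] by simp
      then have "(y, z) \<in> r" using step_first_difference[OF z(1) ag(1)] step_fun[OF st] by metis
      then show False using z(2) antisym \<open>z \<noteq> y\<close> by blast
    qed
    then have "ht z p < ht y p" using step_at[OF st] by simp
    then obtain z' where z': "step p z z'" "(z', y) \<in> r" using step_first_difference[OF z(2) ag(2)] by blast
    have "agree x z (Suc p)" using ag(1) \<open>ht z p = ht x p\<close> by (simp add: agree_def less_Suc_eq)
    then have "(y, z') \<in> r" using step_mono[OF z(1) _ st z'(1)] by blast
    then have "y = z'" using z'(2) antisym by blast
    then show "z = x" using step_inj[OF st] z'(1) by simp
  qed
  then show "(x, y) \<in> covering_relations r"
    using step_le[OF st] step_neq[OF st] by (auto simp: covering_relations_def)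
qed

text \<open>A label has to be computed from the two elements alone; the position of the step is recovered as the
first one at which they differ.\<close>

definition step_label :: "'a \<times> 'a \<Rightarrow> nat \<times> nat" where
  "step_label = (\<lambda>(x, y). let p = (LEAST j. ht x j \<noteq> ht y j) in (p, ht x p))"

lemma step_label_eq:
  assumes "step p x y" shows "step_label (x, y) = (p, ht x p)"
proof -
  have "(LEAST j. ht x j \<noteq> ht y j) = p"
    using step_at[OF assms] step_below[OF assms] by (intro Least_equality) (auto simp: not_less[symmetric])
  then show ?thesis by (simp add: step_label_def)
qed

end

definition lex_nat_pairs :: "(nat \<times> nat) rel" where
  "lex_nat_pairs = {((a, b), (c, d)). a < c \<or> a = c \<and> b \<le> d}"

lemma Field_lex_nat_pairs: "Field lex_nat_pairs = UNIV"
  by (auto simp: Field_def lex_nat_pairs_def)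

lemma Partial_order_lex_nat_pairs: "Partial_order lex_nat_pairs"
  unfolding partial_order_on_def preorder_on_def Field_lex_nat_pairs
  by (auto simp: refl_on_def trans_def antisym_def lex_nat_pairs_def)

lemma maximal_chains_cases:
  assumes "c \<in> maximal_chains r x y"
  obtains "c = [x]" "x = y" | z c' where "c = x # c'" "(x, z) \<in> covering_relations r" "c' \<in> maximal_chains r z y"
proof (cases c)
  case (Cons a c')
  then show ?thesis
    using assms that by (cases c') (auto simp: maximal_chains_def)
qed (use assms in \<open>simp add: maximal_chains_def\<close>)

lemma maximal_chains_Cons:
  "(x, z) \<in> covering_relations r \<Longrightarrow> c \<in> maximal_chains r z y \<Longrightarrow> x # c \<in> maximal_chains r x y"
  by (cases c) (auto simp: maximal_chains_def)

lemma maximal_chains_hd: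
  "c \<in> maximal_chains r x y \<Longrightarrow> \<exists>c'. c = x # c'"
  by (cases c) (auto simp: maximal_chains_def)

lemma label_sequence_Cons: "label_sequence lam (x # z # c) = lam (x, z) # label_sequence lam (z # c)"
  by (simp add: label_sequence_def)

lemma lex_le_Cons: "lex_le L ps qs \<Longrightarrow> lex_le L (p # ps) (p # qs)"
  unfolding lex_le_def
proof (elim disjE exE conjE)
  fix i assume "i < length ps" "i < length qs" "\<forall>j<i. ps ! j = qs ! j" "ps ! i \<noteq> qs ! i" "(ps ! i, qs ! i) \<in> L"
  then show "(length (p # ps) \<le> length (p # qs) \<and> (\<forall>i<length (p # ps). (p # ps) ! i = (p # qs) ! i)) \<or>
    (\<exists>i<length (p # ps). i < length (p # qs) \<and> (\<forall>j<i. (p # ps) ! j = (p # qs) ! j) \<and>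
      (p # ps) ! i \<noteq> (p # qs) ! i \<and> ((p # ps) ! i, (p # qs) ! i) \<in> L)"
    by (intro disjI2 exI[of _ "Suc i"]) (auto simp: less_Suc_eq_0_disj)
qed (auto simp: less_Suc_eq_0_disj)

lemma lex_le_head: "(p, q) \<in> L \<Longrightarrow> p \<noteq> q \<Longrightarrow> lex_le L (p # ps) (q # qs)"
  unfolding lex_le_def by (intro disjI2 exI[of _ 0]) auto

context step_system
begin

lemma maximal_chain_le: "c \<in> maximal_chains r x y \<Longrightarrow> y \<in> Field r \<Longrightarrow> (x, y) \<in> r"
proof (induction c arbitrary: x)
  case (Cons a c)
  from Cons.prems(1) show ?case
  proof (cases rule: maximal_chains_cases)
    case 1
    then show ?thesis using Cons.prems(2) refl by simp
  next
    case (2 z c')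
    then obtain q where q: "step q x z" using covering_relations_eq by auto
    have "(z, y) \<in> r" using Cons.IH[of z] 2 Cons.prems(2) by simp
    then show ?thesis using step_le[OF q] trans by blast
  qed
qed (simp add: maximal_chains_def)

text \<open>In a rising chain the positions of the steps weakly increase, so once they start beyond \<open>p\<close> there is
no step at or before \<open>p\<close>.\<close>

lemma rising_chain_fixes_low_heights:
  assumes "c \<in> maximal_chains r x y" "y \<in> Field r" "rising lex_nat_pairs step_label c"
    and "\<And>l ls. label_sequence step_label c = l # ls \<Longrightarrow> p < fst l"
  shows "ht x p = ht y p"
  using assms
proof (induction c arbitrary: x)
  case (Cons a c)
  from Cons.prems(1) show ?case
  proof (cases rule: maximal_chains_cases)
    case (2 z c')
    then have c: "c = c'" "a = x" by auto
    obtain q where q: "step q x z" using 2 covering_relations_eq by auto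
    obtain c'' where c'': "c = z # c''" using maximal_chains_hd[OF 2(3)] c(1) by blast
    have seq: "label_sequence step_label (a # c) = (q, ht x q) # label_sequence step_label c"
      unfolding c'' c(2) label_sequence_Cons step_label_eq[OF q] ..
    then have pq: "p < q" using Cons.prems(4) by simp
    have ris: "rising lex_nat_pairs step_label c"
      using Cons.prems(3) unfolding rising_def strictly_increasing_def seq by (cases "label_sequence step_label c") auto
    have "p < fst l" if "label_sequence step_label c = l # ls" for l ls
      using Cons.prems(3) pq unfolding rising_def strictly_increasing_def seq that
      by (auto simp: lex_nat_pairs_def)
    then have "ht z p = ht y p" using Cons.IH[OF 2(3)[folded c(1)] Cons.prems(2) ris] by blast
    then show ?thesis using step_below[OF q pq] by simp
  qed auto
qed (simp add: maximal_chains_def)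

text \<open>Let \<open>p\<close> be the first difference of \<open>x\<close> and \<open>y\<close>. The rising chain starts with the step at \<open>p\<close> to \<open>z\<close>
and continues with the rising chain of \<open>[z, y]\<close>; the labels increase at the joint because the height
at \<open>p\<close> has gone up. Chains of \<open>[x, y]\<close> that start at another position \<open>q\<close> have \<open>q > p\<close>, so their first
label is larger, and they are not rising, as they still have to change the height at \<open>p\<close>.\<close>

lemma EL_chain:
  assumes "(x, y) \<in> r"
  shows "\<exists>c \<in> maximal_chains r x y. rising lex_nat_pairs step_label c \<and>
    (\<forall>c' \<in> maximal_chains r x y. rising lex_nat_pairs step_label c' \<longrightarrow> c' = c) \<and>
    (\<forall>c' \<in> maximal_chains r x y.
       lex_le lex_nat_pairs (label_sequence step_label c) (label_sequence step_label c'))"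
  using assms
proof (induction x rule: up_induct)
  case (less x)
  let ?ris = "rising lex_nat_pairs step_label" and ?seq = "label_sequence step_label"
  have yF: "y \<in> Field r" using less.prems by (rule FieldI2)
  show ?case
  proof (cases "x = y")
    case True
    have triv: "c = [y]" if "c \<in> maximal_chains r y y" for c
      using that
    proof (cases rule: maximal_chains_cases)
      case (2 z c')
      then have "(z, y) \<in> r" using maximal_chain_le yF by blast
      then show ?thesis using 2(2) antisym by (auto simp: covering_relations_def)
    qed
    show ?thesis
      unfolding True
    proof (intro bexI[of _ "[y]"] conjI ballI impI)
      show "?ris [y]" by (simp add: rising_def strictly_increasing_def label_sequence_def)
      show "lex_le lex_nat_pairs (?seq [y]) (?seq c')" for c' by (simp add: lex_le_def label_sequence_def)
    qed (use triv in \<open>auto simp: maximal_chains_def\<close>)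
  next
    case False
    obtain p where p: "agree x y p" "ht x p < ht y p" using first_difference[OF less.prems False] .
    obtain z where z: "step p x z" "(z, y) \<in> r" using step_first_difference[OF less.prems p] .
    obtain c where c: "c \<in> maximal_chains r z y" "?ris c"
      and uniq: "\<And>c'. c' \<in> maximal_chains r z y \<Longrightarrow> ?ris c' \<Longrightarrow> c' = c"
      and least: "\<And>c'. c' \<in> maximal_chains r z y \<Longrightarrow> lex_le lex_nat_pairs (?seq c) (?seq c')"
      using less.IH[OF step_le[OF z(1)] step_neq[OF z(1)] z(2)] by blast
    have seq: "?seq (x # c') = (q, ht x q) # ?seq c'" if "step q x u" "c' \<in> maximal_chains r u y" for q u c'
      using maximal_chains_hd[OF that(2)] step_label_eq[OF that(1)] by (auto simp: label_sequence_Cons)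
    have cov: "(x, z) \<in> covering_relations r" using z(1) covering_relations_eq by blast
    have agz: "agree z y p" using agree_between[OF step_le[OF z(1)] z(2) p(1)] by simp
    have first: "((p, ht x p), l) \<in> lex_nat_pairs \<and> (p, ht x p) \<noteq> l" if "?seq c = l # ls" for l ls
      using c(1)
    proof (cases rule: maximal_chains_cases)
      case 1
      then show ?thesis using that by (simp add: label_sequence_def)
    next
      case (2 z2 c2)
      then obtain q where q: "step q z z2" using covering_relations_eq by auto
      have "p \<le> q" using step_position[OF q _ agz] maximal_chain_le[OF 2(3) yF] by blast
      moreover have "l = (q, ht z q)"
        using that maximal_chains_hd[OF 2(3)] step_label_eq[OF q] 2(1) by (auto simp: label_sequence_Cons)
      ultimately show ?thesis using step_at[OF z(1)] by (cases "p = q") (simp_all add: lex_nat_pairs_def)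
    qed
    show ?thesis
    proof (intro bexI[of _ "x # c"] conjI ballI impI)
      show "x # c \<in> maximal_chains r x y" using cov c(1) by (rule maximal_chains_Cons)
      show "?ris (x # c)"
        using c(2) first unfolding rising_def strictly_increasing_def seq[OF z(1) c(1)]
        by (cases "?seq c") auto
    next
      fix c' assume c': "c' \<in> maximal_chains r x y"
      then obtain u c2 where u: "c' = x # c2" "(x, u) \<in> covering_relations r" "c2 \<in> maximal_chains r u y"
        using False by (cases rule: maximal_chains_cases) simp_all
      then obtain q where q: "step q x u" using covering_relations_eq by auto
      have pq: "p \<le> q" using step_position[OF q _ p(1)] maximal_chain_le[OF u(3) yF] by blast
      note seq' = seq[OF q u(3)]
      show "lex_le lex_nat_pairs (?seq (x # c)) (?seq c')"
      proof (cases "p = q")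
        case True
        then have "u = z" using q z(1) step_fun by blast
        then have "lex_le lex_nat_pairs (?seq c) (?seq c2)" using least u(3) by simp
        then show ?thesis unfolding seq[OF z(1) c(1)] u(1) seq' True by (rule lex_le_Cons)
      next
        case False
        then show ?thesis
          unfolding seq[OF z(1) c(1)] u(1) seq' using pq by (intro lex_le_head) (simp_all add: lex_nat_pairs_def)
      qed
      show "c' = x # c" if "?ris c'"
      proof (cases "p = q")
        case True
        then have "u = z" using q z(1) step_fun by blast
        moreover have "?ris c2"
          using that unfolding rising_def strictly_increasing_def u(1) seq' by (cases "?seq c2") auto
        ultimately show ?thesis using uniq u by simp
      next
        case False
        then have "ht x p = ht y p"
          using rising_chain_fixes_low_heights[OF c' yF that] pq unfolding u(1) seq' by simp
        then show ?thesis using p(2) by simp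
      qed
    qed
  qed
qed

theorem EL_labeling_step_label: "EL_labeling r lex_nat_pairs step_label"
  unfolding EL_labeling_def
proof (intro conjI)
  show "step_label ` covering_relations r \<subseteq> Field lex_nat_pairs" by (simp add: Field_lex_nat_pairs)
qed (use Partial_order_lex_nat_pairs EL_chain in blast)+

end

section \<open>Raising blocks of a height function\<close>

definition block :: "(nat \<Rightarrow> nat) \<Rightarrow> nat \<Rightarrow> nat \<Rightarrow> bool" where
  "block h p j \<longleftrightarrow> p \<le> j \<and> (\<forall>l. p < l \<and> l \<le> j \<longrightarrow> h p < h l)"

definition raise :: "nat \<Rightarrow> (nat \<Rightarrow> nat) \<Rightarrow> nat \<Rightarrow> nat" where
  "raise p h j = (if block h p j then Suc (h j) else h j)"

text \<open>The inequality says that the sequence strictly increases from position \<open>p - 1\<close> to \<open>p\<close>.\<close>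

definition raisable :: "nat \<Rightarrow> nat \<Rightarrow> (nat \<Rightarrow> nat) \<Rightarrow> bool" where
  "raisable m p h \<longleftrightarrow> 0 < p \<and> h p < h (p - 1) + m"

text \<open>For \<open>p < q\<close>: the block of \<open>p\<close> ends at \<open>q - 1\<close>, and \<open>q\<close> joins it as soon as it is raised.\<close>

definition touching :: "(nat \<Rightarrow> nat) \<Rightarrow> nat \<Rightarrow> nat \<Rightarrow> bool" where
  "touching h p q \<longleftrightarrow> h q = h p \<and> (\<forall>l. p < l \<and> l < q \<longrightarrow> h p < h l)"

lemma block_self [simp]: "block h p p"
  by (simp add: block_def)

lemma block_le: "block h p j \<Longrightarrow> p \<le> i \<Longrightarrow> i \<le> j \<Longrightarrow> block h p i"
  by (simp add: block_def)

lemma block_Suc: "block h p (Suc j) \<longleftrightarrow> p = Suc j \<or> block h p j \<and> h p < h (Suc j)"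
  by (auto simp: block_def le_Suc_eq)

lemma block_ge: "block h p j \<Longrightarrow> h p \<le> h j"
  unfolding block_def by (metis le_neq_implies_less less_imp_le order_refl)

lemma block_trans: "block h p q \<Longrightarrow> block h q j \<Longrightarrow> block h p j"
proof (unfold block_def, intro conjI allI impI)
  assume *: "p \<le> q \<and> (\<forall>l. p < l \<and> l \<le> q \<longrightarrow> h p < h l)" "q \<le> j \<and> (\<forall>l. q < l \<and> l \<le> j \<longrightarrow> h q < h l)"
  show "p \<le> j" using * by simp
  fix l assume l: "p < l \<and> l \<le> j"
  show "h p < h l"
  proof (cases "l \<le> q")
    case False
    then have "h q < h l" using l * by simp
    moreover have "h p \<le> h q" using block_ge[of h p q] *(1) by (simp add: block_def)
    ultimately show ?thesis by simp
  qed (use * l in blast)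
qed

lemma raise_ge: "h j \<le> raise p h j"
  by (simp add: raise_def)

lemma raise_below: "j < p \<Longrightarrow> raise p h j = h j"
  by (simp add: raise_def block_def)

lemma raise_at: "raise p h p = Suc (h p)"
  by (simp add: raise_def)

lemma block_raise_same: "block (raise p h) p j \<longleftrightarrow> block h p j"
proof
  assume "block h p j"
  then have "block h p l" if "p \<le> l" "l \<le> j" for l using that block_le by blast
  then show "block (raise p h) p j"
    using \<open>block h p j\<close> by (auto simp: block_def[of _ p j] raise_def)
next
  show "block (raise p h) p j \<Longrightarrow> block h p j"
  proof (induction j)
    case (Suc j)
    show ?case
    proof (cases "p \<le> j")
      case True
      have "block (raise p h) p j" using block_le[OF Suc.prems True] by simp
      then have "block h p j" by (rule Suc.IH)
      moreover have "block h p (Suc j)" if "\<not> block h p (Suc j)"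
      proof -
        have "raise p h p < raise p h (Suc j)" using Suc.prems True by (simp add: block_def)
        then have "h p < h (Suc j)" using that by (simp add: raise_def)
        then show ?thesis using \<open>block h p j\<close> by (auto simp: block_def le_Suc_eq)
      qed
      ultimately show ?thesis by blast
    next
      case False
      then show ?thesis using Suc.prems by (auto simp: block_def le_Suc_eq)
    qed
  qed (auto simp: block_def)
qed

text \<open>The block of \<open>p\<close> can be read off from the raised function, by \<open>block_raise_same\<close>, and so be lowered
again.\<close>

lemma raise_inject:
  assumes "raise p h = raise p h'" shows "h = h'"
proof
  fix j
  have "block h p j \<longleftrightarrow> block h' p j"
    using block_raise_same[of p h j] block_raise_same[of p h' j] assms by simp
  then show "h j = h' j" using fun_cong[OF assms, of j] by (simp add: raise_def split: if_splits)
qed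

text \<open>If \<open>q\<close> is outside the block of \<open>p\<close>, nothing from \<open>q\<close> on is raised. If \<open>q\<close> is inside, then so is its
whole block, and the height that ends the block of \<open>q\<close> is either raised together with \<open>q\<close> or left
alone while \<open>q\<close> is raised.\<close>

lemma block_raise_left:
  assumes "p < q" shows "block (raise p h) q j \<longleftrightarrow> block h q j"
proof (cases "block h p q")
  case True
  have "raise p h q < raise p h l \<longleftrightarrow> h q < h l" if "block h q (l - 1)" "q < l" for l
  proof (cases "block h p l")
    case True
    then show ?thesis using \<open>block h p q\<close> by (simp add: raise_def)
  next
    case False
    have "block h p (l - 1)" using \<open>block h p q\<close> that(1) by (rule block_trans)
    then have "h l \<le> h p" using False that(2) assms block_Suc[of h p "l - 1"] by simp
    then have "h l \<le> h q" using block_ge[OF \<open>block h p q\<close>] by simp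
    then show ?thesis using False \<open>block h p q\<close> by (simp add: raise_def)
  qed
  note step = this
  show ?thesis
  proof (induction j)
    case (Suc j)
    have "q < Suc j" if "block h q j" using that by (simp add: block_def)
    then show ?case using Suc step[of "Suc j"] unfolding block_Suc by auto
  qed (auto simp: block_def)
next
  case False
  have "\<not> block h p l" if "q \<le> l" for l using False block_le[of h p l q] that assms by auto
  then show ?thesis by (auto simp: block_def raise_def)
qed

text \<open>Raising the block of \<open>q\<close> can only lengthen the block of \<open>p\<close>, and it does so exactly if the first
height at most \<open>h p\<close> after \<open>p\<close> is at \<open>q\<close> and equals \<open>h p\<close>. The block of \<open>p\<close> then absorbs that of \<open>q\<close>.\<close>

lemma block_raise_right:
  assumes "p < q"
  shows "block (raise q h) p j \<longleftrightarrow> block h p j \<or> touching h p q \<and> block h q j"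
proof -
  have p: "raise q h p = h p" using assms by (rule raise_below)
  show ?thesis
  proof
    assume L: "block (raise q h) p j"
    have "touching h p q \<and> block h q j" if n: "\<not> block h p j"
    proof -
      \<comment> \<open>\<open>l\<close> is the first position after the old block of \<open>p\<close>; being in the new block, it must be \<open>q\<close>.\<close>
      define l where "l = (LEAST l. p < l \<and> l \<le> j \<and> h l \<le> h p)"
      have "\<exists>l. p < l \<and> l \<le> j \<and> h l \<le> h p" using n L by (auto simp: block_def not_less)
      then have "p < l \<and> l \<le> j \<and> h l \<le> h p" unfolding l_def by (rule LeastI_ex)
      then have l: "p < l" "l \<le> j" "h l \<le> h p" by simp_all
      have min: "h p < h i" if "p < i" "i < l" for i
        using not_less_Least[of i "\<lambda>l. p < l \<and> l \<le> j \<and> h l \<le> h p"] that l(2) by (auto simp: l_def)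
      have "h p < raise q h l" using L l p by (auto simp: block_def)
      then have bl: "block h q l" "h l = h p" using l(3) by (auto simp: raise_def split: if_splits)
      have "q = l"
      proof (rule ccontr)
        assume "q \<noteq> l"
        then have "q < l" "h q < h l" using bl(1) by (auto simp: block_def)
        then show False using min[of q] assms bl(2) by simp
      qed
      then have t: "touching h p q" using bl(2) min by (auto simp: touching_def)
      have "block h q j"
        unfolding block_def
      proof (intro conjI allI impI)
        show "q \<le> j" using l \<open>q = l\<close> by simp
        fix i assume i: "q < i \<and> i \<le> j"
        show "h q < h i"
          using i
        proof (induction i rule: less_induct)
          case (less i)
          have *: "h p < raise q h i" using L less.prems assms p by (auto simp: block_def)
          show ?case
          proof (rule ccontr)
            assume c: "\<not> h q < h i"
            then have "\<not> block h q i" using less.prems by (auto simp: block_def)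
            then have "h p < h i" using * by (simp add: raise_def)
            then show False using c t by (simp add: touching_def)
          qed
        qed
      qed
      with t show ?thesis ..
    qed
    then show "block h p j \<or> touching h p q \<and> block h q j" by blast
  next
    assume "block h p j \<or> touching h p q \<and> block h q j"
    then show "block (raise q h) p j"
    proof
      assume "block h p j"
      then show ?thesis using raise_ge[of h _ q] by (auto simp: block_def p intro: less_le_trans)
    next
      assume t: "touching h p q \<and> block h q j"
      show ?thesis
        unfolding block_def p
      proof (intro conjI allI impI)
        show "p \<le> j" using t assms by (auto simp: block_def)
        fix l assume l: "p < l \<and> l \<le> j"
        show "h p < raise q h l"
        proof (cases "l < q")
          case True
          then show ?thesis using t l raise_ge[of h l q] by (auto simp: touching_def intro: less_le_trans)
        next
          case False
          then have "block h q l" using t l by (intro block_le[of h q j l]) simp_all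
          then show ?thesis using block_ge[of h q l] t by (simp add: raise_def touching_def)
        qed
      qed
    qed
  qed
qed

lemma touching_not_block:
  assumes "p < q" "touching h p q" "q \<le> j" shows "\<not> block h p j"
  using assms by (auto simp: touching_def block_def)

text \<open>In the case of touching blocks, raising \<open>q\<close> first merges them, so that the step at \<open>p\<close> raises the
block of \<open>q\<close> a second time.\<close>

lemma raise_raise:
  assumes "p < q"
  shows "raise p (raise q h) =
    (if touching h p q then raise q (raise q (raise p h)) else raise q (raise p h))"
proof
  fix j
  have R: "block (raise q (raise p h)) q j \<longleftrightarrow> block h q j"
    using assms by (simp add: block_raise_same block_raise_left)
  have "\<not> (block h p j \<and> block h q j)" if "touching h p q"
    using touching_not_block[OF assms that] by (auto simp: block_def[of h q j])
  then show "raise p (raise q h) j =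
      (if touching h p q then raise q (raise q (raise p h)) else raise q (raise p h)) j"
    using assms R by (auto simp: raise_def block_raise_left block_raise_right)
qed

lemma raisable_raise:
  assumes "p < q" "raisable m q h" shows "raisable m q (raise p h)"
proof (cases "block h p q")
  case True
  then have "block h p (q - 1)" using block_le[OF True, of "q - 1"] assms(1) by simp
  then show ?thesis using assms True by (simp add: raisable_def raise_def)
next
  case False
  then show ?thesis using assms raise_ge[of h "q - 1" p] by (simp add: raisable_def raise_def)
qed

lemma raisable_raise_twice:
  assumes "p < q" "raisable m q h" "touching h p q"
  shows "raisable m q (raise q (raise p h))"
proof -
  have "block h p (q - 1)" using assms(1,3) by (auto simp: block_def touching_def)
  moreover have "\<not> block h p q" using touching_not_block assms by blast
  moreover have "raise q (raise p h) (q - 1) = raise p h (q - 1)" using assms(1) by (intro raise_below) simp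
  ultimately show ?thesis using assms by (simp add: raisable_def raise_at) (simp add: raise_def)
qed

section \<open>The m-Tamari lattice as a system of steps\<close>

text \<open>With the default value 0 beyond the end, a block that starts before the end also ends before it, so
that blocks need not mention the length.\<close>

definition heights :: "nat \<Rightarrow> nat list \<Rightarrow> nat \<Rightarrow> nat" where
  "heights m a j = (if j < length a then m * j - a ! j else 0)"

lemma heights_add:
  assumes "a \<in> dyck_sequences m n" "j < n"
  shows "a ! j + heights m a j = m * j"
  using assms by (simp add: heights_def dyck_sequences_def)

lemma heights_beyond: "a \<in> dyck_sequences m n \<Longrightarrow> n \<le> j \<Longrightarrow> heights m a j = 0"
  by (simp add: heights_def dyck_sequences_def)

lemma heights_inject:
  assumes "a \<in> dyck_sequences m n" "b \<in> dyck_sequences m n" "heights m a = heights m b"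
  shows "a = b"
proof (rule nth_equalityI)
  show "length a = length b" using assms by (simp add: dyck_sequences_def)
  show "a ! j = b ! j" if "j < length a" for j
  proof -
    have "j < n" using that assms(1) by (simp add: dyck_sequences_def)
    then show ?thesis using heights_add[OF assms(1)] heights_add[OF assms(2)] assms(3)
      by (metis add_right_cancel)
  qed
qed

definition height_profile :: "nat \<Rightarrow> nat \<Rightarrow> (nat \<Rightarrow> nat) \<Rightarrow> bool" where
  "height_profile m n h \<longleftrightarrow> h 0 = 0 \<and> (\<forall>j. h (Suc j) \<le> h j + m) \<and> (\<forall>j\<ge>n. h j = 0)"

lemma heights_image: "heights m ` dyck_sequences m n = {h. height_profile m n h}"
proof (intro equalityI subsetI)
  fix h assume "h \<in> heights m ` dyck_sequences m n"
  then obtain a where a: "a \<in> dyck_sequences m n" and h: "h = heights m a" by blast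
  have "h (Suc j) \<le> h j + m" for j
  proof (cases "Suc j < n")
    case True
    then have "a ! j \<le> a ! Suc j" using a by (auto simp: dyck_sequences_def sorted_iff_nth_mono)
    then show ?thesis using heights_add[OF a True] heights_add[OF a, of j] True by (simp add: h)
  qed (simp add: h heights_beyond[OF a])
  moreover have "h 0 = 0" by (simp add: h heights_def)
  ultimately show "h \<in> {h. height_profile m n h}" by (simp add: height_profile_def h heights_beyond[OF a])
next
  fix h assume "h \<in> {h. height_profile m n h}"
  then have h: "h 0 = 0" "\<And>j. h (Suc j) \<le> h j + m" "\<And>j. n \<le> j \<Longrightarrow> h j = 0"
    by (auto simp: height_profile_def)
  have le: "h j \<le> m * j" for j
  proof (induction j)
    case (Suc j)
    then show ?case using h(2)[of j] by simp
  qed (simp add: h)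
  define a where "a = map (\<lambda>j. m * j - h j) [0..<n]"
  have "a ! j \<le> a ! Suc j" if "Suc j < n" for j
    using that h(2)[of j] le[of j] le[of "Suc j"] by (simp add: a_def)
  then have "a \<in> dyck_sequences m n"
    by (auto simp: dyck_sequences_def sorted_iff_nth_Suc a_def)
  moreover have "heights m a = h"
    using le h(3) by (auto simp: heights_def a_def)
  ultimately show "h \<in> heights m ` dyck_sequences m n" by blast
qed

text \<open>Within a block, and outside it, heights are changed alike; at its left end the inequality is what
\<open>raisable\<close> provides, and at its right end the left-hand neighbour is the one that grows.\<close>

lemma height_profile_raise:
  assumes h: "height_profile m n h" and p: "p < n" "raisable m p h"
  shows "height_profile m n (raise p h)"
  unfolding height_profile_def
proof (intro conjI allI impI)
  show "raise p h 0 = 0" using h p(2) raise_below[of 0 p h] by (simp add: height_profile_def raisable_def)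
  show "raise p h j = 0" if "n \<le> j" for j
  proof -
    have "\<not> block h p j" using that p(1) h by (auto simp: block_def height_profile_def intro!: exI[of _ j])
    then show ?thesis using h that by (simp add: raise_def height_profile_def)
  qed
  fix j
  have hj: "h (Suc j) \<le> h j + m" using h by (simp add: height_profile_def)
  show "raise p h (Suc j) \<le> raise p h j + m"
  proof (cases "block h p (Suc j) \<and> \<not> block h p j")
    case True
    then have "p = Suc j" using block_le[of h p "Suc j" j] by (auto simp: block_def)
    then show ?thesis using p(2) raise_below[of j p h] by (simp add: raise_at raisable_def)
  next
    case False
    then show ?thesis using hj by (auto simp: raise_def)
  qed
qed

definition raise_step :: "nat \<Rightarrow> nat \<Rightarrow> nat \<Rightarrow> nat list \<Rightarrow> nat list \<Rightarrow> bool" where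
  "raise_step m n p a b \<longleftrightarrow> a \<in> dyck_sequences m n \<and> b \<in> dyck_sequences m n \<and> p < n \<and>
     raisable m p (heights m a) \<and> heights m b = raise p (heights m a)"

lemma raise_step_exists:
  assumes "a \<in> dyck_sequences m n" "p < n" "raisable m p (heights m a)"
  obtains b where "raise_step m n p a b"
proof -
  have "height_profile m n (heights m a)" using assms(1) heights_image by blast
  then have "height_profile m n (raise p (heights m a))" using height_profile_raise assms by blast
  then obtain b where "b \<in> dyck_sequences m n" "heights m b = raise p (heights m a)"
    using heights_image by (metis (mono_tags, lifting) imageE mem_Collect_eq)
  then show ?thesis using that assms by (simp add: raise_step_def)
qed

text \<open>In terms of heights, \<open>a\<^sub>j - a\<^sub>p < m (j - p)\<close> says that \<open>h\<^sub>p < h\<^sub>j\<close>.\<close>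

lemma primitive_subsequence_iff_block:
  assumes a: "a \<in> dyck_sequences m n" and k: "primitive_subsequence m a p k"
  shows "p \<le> j \<and> j \<le> k \<longleftrightarrow> block (heights m a) p j"
proof -
  have n: "length a = n" using a by (simp add: dyck_sequences_def)
  have pk: "p \<le> k" "k < n" using k n by (auto simp: primitive_subsequence_def)
  have diff: "int (a ! j) - int (a ! p) < int (m * (j - p)) \<longleftrightarrow> heights m a p < heights m a j"
    if "p < j" "j < n" for j
  proof -
    have "m * (j - p) + m * p = m * j" using that by (simp add: diff_mult_distrib2)
    then have "int (m * (j - p)) + int (m * p) = int (m * j)" by (metis of_nat_add)
    moreover have "int (a ! j) + int (heights m a j) = int (m * j)" "int (a ! p) + int (heights m a p) = int (m * p)"
      using heights_add[OF a, of j] heights_add[OF a, of p] that by (simp_all flip: of_nat_add of_nat_mult)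
    ultimately show ?thesis by linarith
  qed
  show ?thesis
  proof
    assume "p \<le> j \<and> j \<le> k"
    then show "block (heights m a) p j"
      using k diff pk(2) by (auto simp: block_def primitive_subsequence_def)
  next
    assume b: "block (heights m a) p j"
    have "j \<le> k"
    proof (rule ccontr)
      assume "\<not> j \<le> k"
      then have "p < Suc k" "Suc k \<le> j" using pk by auto
      then have less: "heights m a p < heights m a (Suc k)" using b by (auto simp: block_def)
      then have "Suc k < n" using heights_beyond[OF a, of "Suc k"] by (cases "Suc k < n") auto
      then show False using less diff[of "Suc k"] k pk n by (auto simp: primitive_subsequence_def)
    qed
    then show "p \<le> j \<and> j \<le> k" using b by (simp add: block_def)
  qed
qed

lemma primitive_subsequence_exists:
  assumes a: "a \<in> dyck_sequences m n" and p: "p < n"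
  obtains k where "primitive_subsequence m a p k"
proof -
  have n: "length a = n" using a by (simp add: dyck_sequences_def)
  let ?P = "\<lambda>k. p \<le> k \<and> (Suc k = n \<or> int (a ! Suc k) - int (a ! p) \<ge> int (m * (Suc k - p)))"
  have "?P (n - 1)" using p by auto
  then have k: "?P (LEAST k. ?P k)" and le: "(LEAST k. ?P k) \<le> n - 1"
    by (rule LeastI, rule Least_le)
  have "int (a ! j) - int (a ! p) < int (m * (j - p))" if "p < j" "j \<le> (LEAST k. ?P k)" for j
  proof -
    have "j - 1 < (LEAST k. ?P k)" using that by simp
    then have "\<not> ?P (j - 1)" by (rule not_less_Least)
    then show ?thesis using that(1) by auto
  qed
  then have "primitive_subsequence m a p (LEAST k. ?P k)"
    unfolding primitive_subsequence_def n using k le p by auto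
  then show ?thesis by (rule that)
qed

lemma tamari_step_iff: "(a, b) \<in> tamari_step m n \<longleftrightarrow> (\<exists>p. raise_step m n p a b)"
proof -
  have main: "a ! i < a ! Suc i \<and> b = map (\<lambda>j. if Suc i \<le> j \<and> j \<le> k then a ! j - 1 else a ! j) [0..<n]
      \<longleftrightarrow> raise_step m n (Suc i) a b"
    if a: "a \<in> dyck_sequences m n" and b: "b \<in> dyck_sequences m n" and i: "Suc i < n"
      and k: "primitive_subsequence m a (Suc i) k" for i k
  proof -
    have n: "length a = n" "length b = n" using a b by (auto simp: dyck_sequences_def)
    have add: "a ! j + heights m a j = m * j" "b ! j + heights m b j = m * j" if "j < n" for j
      using heights_add[OF a that] heights_add[OF b that] by auto
    have asc: "a ! i < a ! Suc i \<longleftrightarrow> raisable m (Suc i) (heights m a)"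
      using add(1)[of i] add(1)[of "Suc i"] i by (auto simp: raisable_def)
    have "b = map (\<lambda>j. if Suc i \<le> j \<and> j \<le> k then a ! j - 1 else a ! j) [0..<n]
        \<longleftrightarrow> heights m b = raise (Suc i) (heights m a)" if lt: "a ! i < a ! Suc i"
    proof -
      have pos: "0 < a ! j" if "Suc i \<le> j" "j < n" for j
        using lt sorted_nth_mono[of a "Suc i" j] a that n by (auto simp: dyck_sequences_def)
      have "b = map (\<lambda>j. if Suc i \<le> j \<and> j \<le> k then a ! j - 1 else a ! j) [0..<n]
        \<longleftrightarrow> (\<forall>j<n. b ! j = (if Suc i \<le> j \<and> j \<le> k then a ! j - 1 else a ! j))"
        using n by (auto simp: list_eq_iff_nth_eq)
      also have "\<dots> \<longleftrightarrow> (\<forall>j<n. heights m b j = raise (Suc i) (heights m a) j)"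
      proof (intro all_cong)
        fix j assume j: "j < n"
        show "b ! j = (if Suc i \<le> j \<and> j \<le> k then a ! j - 1 else a ! j) \<longleftrightarrow>
            heights m b j = raise (Suc i) (heights m a) j"
          using add[OF j] pos[OF _ j] primitive_subsequence_iff_block[OF a k, of j]
          by (auto simp: raise_def)
      qed
      also have "\<dots> \<longleftrightarrow> heights m b = raise (Suc i) (heights m a)"
      proof -
        have "height_profile m n (heights m a)" using a heights_image by blast
        then have "height_profile m n (raise (Suc i) (heights m a))"
          using height_profile_raise i lt asc by blast
        then have "raise (Suc i) (heights m a) j = 0" if "n \<le> j" for j
          using that by (simp add: height_profile_def)
        then show ?thesis using heights_beyond[OF b] by (auto simp: fun_eq_iff) (metis not_le)
      qed
      finally show ?thesis .
    qed
    then show ?thesis using asc a b i by (auto simp: raise_step_def)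
  qed
  show ?thesis
  proof
    assume "(a, b) \<in> tamari_step m n"
    then show "\<exists>p. raise_step m n p a b" unfolding tamari_step_def using main by blast
  next
    assume "\<exists>p. raise_step m n p a b"
    then obtain p where p: "raise_step m n p a b" by blast
    then have ab: "a \<in> dyck_sequences m n" "b \<in> dyck_sequences m n" "p < n" "0 < p"
      by (auto simp: raise_step_def raisable_def)
    then obtain i where i: "p = Suc i" by (cases p) auto
    obtain k where k: "primitive_subsequence m a p k" using primitive_subsequence_exists ab by blast
    show "(a, b) \<in> tamari_step m n"
      unfolding tamari_step_def using main[of i k] ab i k p by blast
  qed
qed

lemma step_system_tamari:
  "step_system (tamari m n) (raise_step m n) (heights m) (\<lambda>a. touching (heights m a))"
proof
  show "Partial_order (tamari m n)" by (rule Partial_order_tamari)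
  show "finite (Field (tamari m n))" by (simp add: Field_tamari finite_dyck_sequences)
  show "((x, y) \<in> tamari m n) = (x \<in> Field (tamari m n) \<and> (\<lambda>u v. \<exists>p. raise_step m n p u v)\<^sup>*\<^sup>* x y)" for x y
  proof -
    have "(\<lambda>u v. \<exists>p. raise_step m n p u v)\<^sup>*\<^sup>* x y \<longleftrightarrow> (x, y) \<in> (tamari_step m n)\<^sup>*"
      by (simp add: rtranclp_rtrancl_eq flip: tamari_step_iff)
    moreover have "y \<in> dyck_sequences m n" if "(x, y) \<in> (tamari_step m n)\<^sup>*" "x \<in> dyck_sequences m n"
      using that by induction (auto simp: tamari_step_def)
    ultimately show ?thesis unfolding Field_tamari by (auto simp: tamari_def)
  qed
next
  fix p x y assume s: "raise_step m n p x y"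
  show "x \<in> Field (tamari m n) \<and> y \<in> Field (tamari m n)" using s by (simp add: Field_tamari raise_step_def)
  show "j < p \<Longrightarrow> heights m y j = heights m x j" for j using s by (simp add: raise_step_def raise_below)
  show "heights m y p = Suc (heights m x p)" using s by (simp add: raise_step_def raise_at)
  show "heights m x j \<le> heights m y j" for j using s by (simp add: raise_step_def raise_ge)
  show "y = y'" if "raise_step m n p x y'" for y'
    using s that heights_inject[of y m n y'] by (simp add: raise_step_def)
  show "\<exists>y'. raise_step m n p z y'"
    if "z \<in> Field (tamari m n)" "\<And>j. j \<le> p \<Longrightarrow> heights m z j = heights m x j" for z
  proof -
    have "raisable m p (heights m z)" using s that(2)[of p] that(2)[of "p - 1"] by (simp add: raise_step_def raisable_def)
    then show ?thesis
      using raise_step_exists[of z m n p] that(1) s unfolding Field_tamari by (auto simp: raise_step_def)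
  qed
next
  fix p x y z assume "raise_step m n p x z" "raise_step m n p y z"
  then show "x = y" using raise_inject[of p "heights m x" "heights m y"] heights_inject[of x m n y]
    by (simp add: raise_step_def)
next
  show "x \<in> Field (tamari m n) \<Longrightarrow> y \<in> Field (tamari m n) \<Longrightarrow> heights m x = heights m y \<Longrightarrow> x = y" for x y
    using heights_inject unfolding Field_tamari by blast
next
  fix x y p q assume "p < q" "touching (heights m x) p q" "\<And>j. j \<le> q \<Longrightarrow> heights m y j = heights m x j"
  then show "touching (heights m y) p q" by (simp add: touching_def)
next
  fix p q x u v w
  assume pq: "p < q" and x: "raise_step m n p x u" "raise_step m n q x v" and w: "raise_step m n p v w"
  have q: "q < n" "raisable m q (heights m x)" and uF: "u \<in> dyck_sequences m n" "heights m u = raise p (heights m x)"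
    using x by (simp_all add: raise_step_def)
  have hw: "heights m w = raise p (raise q (heights m x))" "w \<in> dyck_sequences m n"
    using w x by (simp_all add: raise_step_def)
  obtain u1 where u1: "raise_step m n q u u1"
    using raise_step_exists[OF uF(1) q(1)] raisable_raise[OF pq q(2)] uF(2) by metis
  have hu1: "heights m u1 = raise q (raise p (heights m x))" using u1 uF by (simp add: raise_step_def)
  show "if touching (heights m x) p q then \<exists>u'. raise_step m n q u u' \<and> raise_step m n q u' w
    else raise_step m n q u w"
  proof (cases "touching (heights m x) p q")
    case True
    have "u1 \<in> dyck_sequences m n" using u1 by (simp add: raise_step_def)
    moreover have "raisable m q (heights m u1)"
      unfolding hu1 using raisable_raise_twice pq q(2) True by blast
    ultimately have "raise_step m n q u1 w"
      using hw q(1) by (simp add: raise_step_def hu1 raise_raise[OF pq] True)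
    then show ?thesis using u1 True by auto
  next
    case False
    then have "u1 = w"
      using heights_inject[of u1 m n w] u1 hu1 hw raise_raise[OF pq, of "heights m x"] by (simp add: raise_step_def)
    then show ?thesis using u1 False by simp
  qed
qed

text \<open>Every height function that is not zero arises by a step: lower it at the last position with a
positive height, whose block is a single position. A height function at which no step is possible
satisfies \<open>h\<^sub>j = m j\<close> for \<open>j < n\<close>.\<close>

lemma bounded_poset_tamari: "bounded_poset (tamari m n)"
proof -
  interpret step_system "tamari m n" "raise_step m n" "heights m" "\<lambda>a. touching (heights m a)"
    by (rule step_system_tamari)
  let ?D = "dyck_sequences m n"
  have "height_profile m n (\<lambda>_. 0)" by (simp add: height_profile_def)
  then obtain bot where bot: "bot \<in> ?D" "heights m bot = (\<lambda>_. 0)"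
    using heights_image[of m n] by (metis (mono_tags, lifting) imageE mem_Collect_eq)
  have "height_profile m n (\<lambda>j. if j < n then m * j else 0)" by (simp add: height_profile_def)
  then obtain top where top: "top \<in> ?D" "heights m top = (\<lambda>j. if j < n then m * j else 0)"
    using heights_image[of m n] by (metis (mono_tags, lifting) imageE mem_Collect_eq)
  have hp: "height_profile m n (heights m a)" if "a \<in> ?D" for a using that heights_image by blast
  have le_top: "heights m a j \<le> heights m top j" if "a \<in> ?D" for a j
    using heights_add[OF that, of j] heights_beyond[OF that, of j] by (cases "j < n") (auto simp: top)
  have min: "(\<forall>y. (y, a) \<in> tamari m n \<longrightarrow> y = a) \<longleftrightarrow> a = bot" if a: "a \<in> ?D" for a
  proof
    assume min: "\<forall>y. (y, a) \<in> tamari m n \<longrightarrow> y = a"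
    let ?h = "heights m a"
    show "a = bot"
    proof (rule ccontr)
      assume "a \<noteq> bot"
      then have "?h \<noteq> (\<lambda>_. 0)" using heights_inject[OF a bot(1)] bot(2) by auto
      then obtain i where i: "0 < ?h i" by auto
      have bound: "j \<le> n" if "0 < ?h j" for j
        using that heights_beyond[OF a, of j] by (cases "n \<le> j") auto
      define p where "p = (GREATEST j. 0 < ?h j)"
      have p: "0 < ?h p" unfolding p_def using i bound by (rule GreatestI_nat)
      have last: "?h j = 0" if "p < j" for j
        using Greatest_le_nat[of "\<lambda>j. 0 < ?h j" j n] bound that unfolding p_def by fastforce
      have pn: "p < n" using p heights_beyond[OF a, of p] by (cases "p < n") auto
      have p0: "0 < p" using p hp[OF a] by (cases p) (auto simp: height_profile_def)
      \<comment> \<open>the height function from which \<open>a\<close> arises by a step at \<open>p\<close>\<close>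
      define h where "h = ?h(p := ?h p - 1)"
      have "height_profile m n h"
        unfolding height_profile_def
      proof (intro conjI allI impI)
        show "h 0 = 0" using hp[OF a] p0 by (simp add: h_def height_profile_def)
        show "h j = 0" if "n \<le> j" for j using hp[OF a] that pn by (simp add: h_def height_profile_def)
        show "h (Suc j) \<le> h j + m" for j
          using hp[OF a] last[of "Suc j"] by (auto simp: h_def height_profile_def le_diff_conv intro: le_SucI)
      qed
      then obtain b where b: "b \<in> ?D" "heights m b = h"
        using heights_image[of m n] by (metis (mono_tags, lifting) imageE mem_Collect_eq)
      have "block h p j \<longleftrightarrow> j = p" for j
        using last[of "Suc p"] by (auto simp: block_def h_def intro!: exI[of _ "Suc p"])
      then have "raise p h = ?h" using p by (auto simp: raise_def h_def)
      moreover have "raisable m p h"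
      proof -
        have "?h (Suc (p - 1)) \<le> ?h (p - 1) + m" using hp[OF a] by (simp only: height_profile_def)
        moreover have "h (p - 1) = ?h (p - 1)" "h p = ?h p - 1" using p0 by (auto simp: h_def)
        ultimately show ?thesis using p p0 by (simp add: raisable_def)
      qed
      ultimately have "raise_step m n p b a" using a b pn by (simp add: raise_step_def)
      then show False using min step_le step_neq by blast
    qed
  next
    assume "a = bot"
    show "\<forall>y. (y, a) \<in> tamari m n \<longrightarrow> y = a"
    proof (intro allI impI)
      fix y assume y: "(y, a) \<in> tamari m n"
      have "heights m y j = heights m bot j" for j
        using ht_mono[OF y, of j] by (simp add: \<open>a = bot\<close> bot)
      then have "heights m y = heights m bot" ..
      moreover have "y \<in> ?D" using y by (simp add: tamari_def)
      ultimately show "y = a" using heights_inject bot(1) \<open>a = bot\<close> by simp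
    qed
  qed
  have max: "(\<forall>y. (a, y) \<in> tamari m n \<longrightarrow> y = a) \<longleftrightarrow> a = top" if a: "a \<in> ?D" for a
  proof
    assume max: "\<forall>y. (a, y) \<in> tamari m n \<longrightarrow> y = a"
    have no: "\<not> raisable m p (heights m a)" if "p < n" for p
      using raise_step_exists[OF a that] max step_le step_neq by metis
    have "heights m a j = m * j" if "j < n" for j
      using that
    proof (induction j)
      case 0
      then show ?case by (simp add: heights_def)
    next
      case (Suc j)
      then have "heights m a j + m \<le> heights m a (Suc j)" using no[of "Suc j"] by (simp add: raisable_def)
      then show ?case using Suc le_top[OF a, of "Suc j"] by (simp add: top)
    qed
    then have "heights m a = heights m top" using heights_beyond[OF a] by (auto simp: top)
    then show "a = top" using heights_inject a top(1) by blast
  next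
    assume "a = top"
    show "\<forall>y. (a, y) \<in> tamari m n \<longrightarrow> y = a"
    proof (intro allI impI)
      fix y assume y: "(a, y) \<in> tamari m n"
      have yD: "y \<in> ?D" using y by (simp add: tamari_def)
      have "heights m y j = heights m top j" for j
        using ht_mono[OF y, of j] le_top[OF yD, of j] unfolding \<open>a = top\<close> by (rule order_antisym[rotated])
      then have "heights m y = heights m top" ..
      then show "y = a" using heights_inject yD top(1) \<open>a = top\<close> by simp
    qed
  qed
  show ?thesis
    unfolding bounded_poset_def Field_tamari
  proof (intro conjI)
    show "\<exists>!x. x \<in> ?D \<and> (\<forall>y. (y, x) \<in> tamari m n \<longrightarrow> y = x)"
      by (rule ex1I[of _ bot]) (simp_all add: min bot(1) cong: conj_cong)
    show "\<exists>!x. x \<in> ?D \<and> (\<forall>y. (x, y) \<in> tamari m n \<longrightarrow> y = x)"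
      by (rule ex1I[of _ top]) (simp_all add: max top(1) cong: conj_cong)
  qed (use Partial_order_tamari[of m n] in \<open>simp add: Field_tamari\<close>)
qed

theorem theorem1p1:
  fixes m n :: nat
  assumes "0 < m" and "0 < n"
  shows "EL_shellable (tamari m n) \<and>
    (\<forall>(a, b) \<in> tamari m n. poset_moebius (tamari m n) a b \<in> {-1, 0, 1}) \<and>
    (\<forall>(a, b) \<in> tamari m n.
       let X = geometric_realization (order_complex (tamari m n) (open_interval (tamari m n) a b))
       in homotopic_to_sphere X \<or> homotopic_to_point X)"
proof -
  interpret step_system "tamari m n" "raise_step m n" "heights m" "\<lambda>a. touching (heights m a)"
    by (rule step_system_tamari)
  have "poset_moebius (tamari m n) a b \<in> {-1, 0, 1} \<and>
      (homotopic_to_sphere (order_realization (tamari m n) (open_interval (tamari m n) a b)) \<or>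
       homotopic_to_point (order_realization (tamari m n) (open_interval (tamari m n) a b)))"
    if ab: "(a, b) \<in> tamari m n" for a b
  proof -
    obtain d \<alpha> \<gamma> where "boolean_model (tamari m n) a b d \<alpha> \<gamma>" using boolean_model_exists[OF ab] by blast
    then interpret boolean_model "tamari m n" a b d \<alpha> \<gamma> .
    show ?thesis using moebius_value[OF locally_finite_tamari] open_interval_homotopy_type by blast
  qed
  then show ?thesis
    using EL_shellableI[OF bounded_poset_tamari EL_labeling_step_label]
    by (auto simp: Let_def order_realization_def)
qed

end
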